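(* Let $(L/K,v)$ be a simple algebraic extension of valued fields, $L=K(\eta)$, with $e(L/K,v)=[vL:vK]=1$ and $v(\eta)=0$, and let $\mathbf Q=\{Q_i\}_{i\in I}$ be a complete sequence of key polynomials for the induced valuation $\nu$ on $K[x]$, normalized as described in the context and successively strongly monic. Then there exist subsets $\tilde I^{(q)}\subseteq I^{(q)}$ with $\#\tilde I^{(q)}=\#I^{(q)}$ for $q\in\{1,\dots,w\}$ such that, after replacing $I^*$ by $\tilde I^*=\coprod_{q=1}^w\tilde I^{(q)}$ (with the induced ordering; thus $I$ is replaced by $\tilde I^*\cup\{i_{\max}\}$ and all the notions in the context are taken with respect to this new index set), it is possible to choose, for each neat pair $(\ell,i)$, a full $i$-th expansion of $\tilde Q_\ell$ in such a way that $\tilde{\mathbf Q}$ becomes neat, i.e. for every neat pair $(\ell,i)$ the chosen full $i$-th expansion of $\tilde Q_\ell$ is neat of level $s(\ell,i)$.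
   Context: **Valuation on $K[x]$.** $\nu(f):=v(f(\eta))$ for $f\in K[x]$ (so $\nu(f)=\infty$ iff the monic minimal polynomial $g$ of $\eta$ over $K$ divides $f$). For a monic nonconstant $q\in K[x]$ and $f=f_0+f_1q+\dots+f_nq^n$ with $\deg f_j<\deg q$ (the $q$-expansion of $f$), the truncation of $\nu$ at $q$ is $\nu_q(f)=\min_j\nu(f_jq^j)$. A set $\mathbf Q\subseteq K[x]\setminus K$ is complete for $\nu$ if for every $f\in K[x]\setminus K$ there is $q\in\mathbf Q$ with $\deg q\le\deg f$ and $\nu_q(f)=\nu(f)$. **Key polynomials.** Fix an extension $\overline\nu$ of $\nu$ to $\overline K[x]$, $\overline K$ an algebraic closure of $K$. For $f\in K[x]\setminus K$ put $\epsilon(f)=\max\{\overline\nu(x-a)\mid a\text{ a root of }f\}$. A monic $Q\in K[x]\setminus K$ is a key polynomial for $\nu$ if $\epsilon(f)<\epsilon(Q)$ for all $f\in K[x]\setminus K$ with $\deg f<\deg Q$. A complete sequence of key polynomials is a family $\mathbf Q=\{Q_i\}_{i\in I}$ of key polynomials, $I$ well ordered, $i\mapsto\epsilon(Q_i)$ strictly increasing, which is a complete set for $\nu$. Then $I$ has a largest element $i_{\max}$ and $Q_{i_{\max}}=g$. Put $I^*=I\setminus\{i_{\max}\}$ and $\nu_i:=\nu_{Q_i}$ for $i\in I^*$. **Normalizations (standing assumptions).** Let $1=n_1<n_2<\dots<n_{w+1}=\deg g$ be the degrees of the elements of $\mathbf Q$ and $I^{(q)}=\{i\in I\mid\deg Q_i=n_q\}$,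 so $I=\coprod_{q=1}^{w+1}I^{(q)}$, $I^{(1)}<\dots<I^{(w)}<I^{(w+1)}=\{i_{\max}\}$. Each $I^{(q)}$ is either a singleton or order-isomorphic to $\mathbb N$. For $n=n_q$ with $q\le w$, put $n_+=n_{q+1}$. Let $\ell_q$ be the smallest element of $I^{(q)}$; for $\ell\in I$, $q_\ell$ is the unique index with $\ell\in I^{(q_\ell)}$; for $i\in I^{(q)}$, $i-\ell_q\in\mathbb N$ is the number of elements of $I^{(q)}$ strictly smaller than $i$; $i+1$ is the immediate successor of $i$ in $I$. For $i\in I^*$ choose $a_i\in K$ with $v(a_i)=\nu(Q_i)$ and put $\tilde Q_i=Q_i/a_i$; put $\tilde Q_{i_{\max}}=g$. For the initial family one has $\tilde Q_{\ell_1}=x$ (this is not required of the family obtained after replacing $I^*$). $\tilde{\mathbf Q}=\{\tilde Q_i\}_{i\in I}$. For $\lambda:I\to\mathbb N$ with finite support, $\tilde{\mathbf Q}^\lambda=\prod_i\tilde Q_i^{\lambda(i)}$. **Full $i$-th expansions.** For $i\in I^*$ and $0\ne f\in K[x]$, a full $i$-th expansion of $f$ is an expression $f=\sum_{j=1}^rb_j\tilde{\mathbf Q}^{\lambda_j}$, $b_j\in K$, with $\lambda_j(k)=0$ for $k>i$, such that: (1) $\nu_i(f)=\min_{1\le j\le r}v(b_j)$; (2) if $k<i$ then $\lambda_j(k)<(\deg Q_k)_+/\deg Q_k$ for all $j$; (3) for each $q\in\{1,\dots,w\}$ there is at most one $k\in I^{(q)}$ such that $\tilde Q_k$ appears (i.e.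 $\lambda_j(k)>0$ for some $j$); this $k$ is denoted $j(f,q)$, and $j(f,q)=-\infty$ if there is none. The expansion is neat if there is $s\in\mathbb N$ with $j(f,q)-\ell_q=s$ for all $q\in\{1,\dots,w\}$ such that $\#I^{(q)}=\infty$ and $j(f,q)>-\infty$; it is then neat of level $s$ if the set of such $q$ is non-empty, and neat of level $0$ if that set is empty. **Successors and neat pairs.** For $i<\ell$ in $I$, write $Q_i<_{\rm succ}Q_\ell$ if either $\ell=i+1$, or $\#I^{(q_i)}=\infty$ and $q_\ell=q_i+1$. For such a pair the level is $s(\ell,i)=i-\ell_{q_i}$ if $\ell=i+1$, and $s(\ell,i)=\max\{i-\ell_{q_i},\ell-\ell_{q_\ell}\}$ otherwise. The pair $(\ell,i)$, $i,\ell\in I$ (with $Q_i<_{\rm succ}Q_\ell$) is neat if the following implication holds: if $q_i\ne q_\ell$ and $\#I^{(q_i)}=\#I^{(q_\ell)}=\infty$, then $i-\ell_{q_i}=\ell-\ell_{q_\ell}$. **Successively strongly monic.** For $Q_i<_{\rm succ}Q_\ell$ with $Q_i$-expansion $Q_\ell=\sum_{j=0}^{r_{\ell i}}q_jQ_i^j$ ($q_{r_{\ell i}}\neq 0$), $Q_\ell$ is strongly $Q_i$-monic if $q_{r_{\ell i}}=1$ and $\nu(Q_i^{r_{\ell i}})=\nu_i(Q_\ell)$. $\mathbf Q$ is successively strongly monic if this holds for all $i,\ell\in I^*$ with $Q_i<_{\rm succ}Q_\ell$. *)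

theory Defs
  imports
    Complex_Main
    "HOL-Computational_Algebra.Polynomial"
    "HOL-Library.Extended"
    "HOL-Library.Equipollence"
    "HOL-Library.Poly_Mapping"
begin

section \<open>Valuations and valued field extensions\<close>

text \<open>
  Valuations are written additively. The value group need not be exhausted by the values, and the
  support may be a nonzero prime ideal. The type \<open>extended\<close> also contains \<open>-\<infinity>\<close>, which is
  excluded explicitly.
\<close>
definition valuation :: "('r::comm_ring_1 \<Rightarrow> 'g::linordered_ab_group_add extended) \<Rightarrow> bool" where
  "valuation v \<longleftrightarrow>
     v 0 = \<infinity> \<and> v 1 = 0 \<and> (\<forall>x. v x \<noteq> -\<infinity>) \<and>
     (\<forall>x y. v (x * y) = v x + v y) \<and> (\<forall>x y. min (v x) (v y) \<le> v (x + y))"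

lemma valuation_field_infinity_iff:
  fixes v :: "'r::field \<Rightarrow> 'g::linordered_ab_group_add extended"
  assumes "valuation v"
  shows "v x = \<infinity> \<longleftrightarrow> x = 0"
proof
  assume inf: "v x = \<infinity>"
  show "x = 0"
  proof (rule ccontr)
    assume "x \<noteq> 0"
    then have "v (x * inverse x) = 0" using assms by (simp add: valuation_def)
    moreover have "v (x * inverse x) = \<infinity> + v (inverse x)"
      using assms inf by (simp add: valuation_def)
    ultimately show False by (cases "v (inverse x)") (auto simp: zero_extended_def)
  qed
qed (use assms in \<open>simp add: valuation_def\<close>)

definition field_embedding :: "('k::field \<Rightarrow> 'l::field) \<Rightarrow> bool" where
  "field_embedding \<iota> \<longleftrightarrow>
     \<iota> 1 = 1 \<and> (\<forall>x y. \<iota> (x + y) = \<iota> x + \<iota> y) \<and> (\<forall>x y. \<iota> (x * y) = \<iota> x * \<iota> y)"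

definition algebraic_over :: "('k::field \<Rightarrow> 'l::field) \<Rightarrow> 'l \<Rightarrow> bool" where
  "algebraic_over \<iota> y \<longleftrightarrow> (\<exists>p. p \<noteq> 0 \<and> poly (map_poly \<iota> p) y = 0)"

definition is_subfield :: "'l::field set \<Rightarrow> bool" where
  "is_subfield F \<longleftrightarrow>
     1 \<in> F \<and> (\<forall>x\<in>F. \<forall>y\<in>F. x - y \<in> F \<and> x * y \<in> F) \<and> (\<forall>x\<in>F. inverse x \<in> F)"

definition adjoin :: "('k::field \<Rightarrow> 'l::field) \<Rightarrow> 'l \<Rightarrow> 'l set" where
  "adjoin \<iota> \<eta> = \<Inter>{F. is_subfield F \<and> range \<iota> \<subseteq> F \<and> \<eta> \<in> F}"

definition simple_algebraic_extension :: "('k::field \<Rightarrow> 'l::field) \<Rightarrow> 'l \<Rightarrow> bool" where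
  "simple_algebraic_extension \<iota> \<eta> \<longleftrightarrow>
     field_embedding \<iota> \<and> algebraic_over \<iota> \<eta> \<and> adjoin \<iota> \<eta> = UNIV"

definition algebraic_closure_of :: "('k::field \<Rightarrow> 'c::alg_closed_field) \<Rightarrow> bool" where
  "algebraic_closure_of \<kappa> \<longleftrightarrow> field_embedding \<kappa> \<and> (\<forall>c. algebraic_over \<kappa> c)"

definition is_minimal_polynomial :: "('k::field \<Rightarrow> 'l::field) \<Rightarrow> 'l \<Rightarrow> 'k poly \<Rightarrow> bool" where
  "is_minimal_polynomial \<iota> \<eta> g \<longleftrightarrow>
     lead_coeff g = 1 \<and> poly (map_poly \<iota> g) \<eta> = 0 \<and>
     (\<forall>f. f \<noteq> 0 \<and> poly (map_poly \<iota> f) \<eta> = 0 \<longrightarrow> degree g \<le> degree f)"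

definition value_group :: "('l \<Rightarrow> 'g extended) \<Rightarrow> 'l set \<Rightarrow> 'g set" where
  "value_group v S = {\<gamma>. \<exists>x\<in>S. v x = Fin \<gamma>}"

text \<open>The index \<open>[vL : vK]\<close>, counted as a number of cosets; it is \<open>0\<close> if the index is infinite.\<close>
definition ramification_index ::
    "('k \<Rightarrow> 'l) \<Rightarrow> ('l \<Rightarrow> 'g::linordered_ab_group_add extended) \<Rightarrow> nat" where
  "ramification_index \<iota> v =
     card ((\<lambda>\<alpha>. (\<lambda>\<beta>. \<alpha> + \<beta>) ` value_group v (range \<iota>)) ` value_group v UNIV)"

definition induced_valuation ::
    "('k::field \<Rightarrow> 'l::field) \<Rightarrow> 'l \<Rightarrow> ('l \<Rightarrow> 'g extended) \<Rightarrow> 'k poly \<Rightarrow> 'g extended" where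
  "induced_valuation \<iota> \<eta> v f = v (poly (map_poly \<iota> f) \<eta>)"


section \<open>Expansions and truncations\<close>

text \<open>
  The \<open>q\<close>-expansion \<open>f = f\<^sub>0 + f\<^sub>1 q + \<dots> + f\<^sub>n q\<^sup>n\<close> is the polynomial \<open>F\<close> over \<open>K[x]\<close>
  with coefficients \<open>f\<^sub>j\<close>.
\<close>
definition is_expansion :: "'k::field poly \<Rightarrow> 'k poly \<Rightarrow> 'k poly poly \<Rightarrow> bool" where
  "is_expansion q f F \<longleftrightarrow> poly F q = f \<and> (\<forall>j. degree (coeff F j) < degree q)"

definition expansion :: "'k::field poly \<Rightarrow> 'k poly \<Rightarrow> 'k poly poly" where
  "expansion q f = (THE F. is_expansion q f F)"

lemma is_expansion_exists:
  fixes q f :: "'k::field poly"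
  assumes "degree q > 0"
  shows "\<exists>F. is_expansion q f F"
proof (induction "degree f" arbitrary: f rule: less_induct)
  case less
  show ?case
  proof (cases "degree f < degree q")
    case True
    then show ?thesis
      using assms
      by (intro exI[of _ "[:f:]"]) (auto simp: is_expansion_def coeff_pCons split: nat.splits)
  next
    case False
    have "degree (f div q) < degree f"
      using assms False by (metis degree_div_less gr0I not_less)
    then obtain H where H: "is_expansion q (f div q) H" using less by blast
    have "degree (f mod q) < degree q"
      using assms by (metis degree_0 degree_mod_less' not_gr_zero)
    with H show ?thesis
      by (intro exI[of _ "pCons (f mod q) H"])
        (auto simp: is_expansion_def coeff_pCons split: nat.splits)
  qed
qed

lemma is_expansion_unique:
  fixes q f :: "'k::field poly"
  assumes "is_expansion q f F" "is_expansion q f G"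
  shows "F = G"
  using assms
proof (induction F arbitrary: f G)
  case 0
  then show ?case
  proof (induction G arbitrary: f)
    case (pCons c G)
    have c: "degree c < degree q" and f: "f = 0" "c + q * poly G q = 0"
      using pCons.prems by (auto simp: is_expansion_def dest: spec[of _ 0])
    have "c = 0"
    proof -
      have "q dvd c" using f by (metis add_eq_0_iff dvd_minus_iff dvd_triv_left)
      with c show ?thesis using dvd_imp_degree_le by fastforce
    qed
    moreover have "is_expansion q 0 G"
      using pCons.prems f c \<open>c = 0\<close>
      by (auto simp: is_expansion_def dest: spec[of _ "Suc _"])
    moreover have "is_expansion q 0 0" using c by (auto simp: is_expansion_def)
    ultimately show ?case using pCons.IH by force
  qed simp
next
  case (pCons c F)
  obtain d G' where G: "G = pCons d G'" by (cases G) auto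
  have cd: "degree c < degree q" "degree d < degree q"
    using pCons.prems by (auto simp: is_expansion_def G dest: spec[of _ 0])
  have eq: "c + q * poly F q = d + q * poly G' q"
    using pCons.prems by (auto simp: is_expansion_def G)
  have "c - d = q * (poly G' q - poly F q)" using eq by (simp add: algebra_simps)
  then have "q dvd c - d" by simp
  moreover have "degree (c - d) < degree q" using cd degree_diff_less by blast
  ultimately have "c = d" using dvd_imp_degree_le by fastforce
  moreover have "poly F q = poly G' q" using eq \<open>c = d\<close> cd by auto
  then have "is_expansion q (poly F q) F" "is_expansion q (poly F q) G'"
    using pCons.prems by (auto simp: is_expansion_def G dest: spec[of _ "Suc _"])
  ultimately show ?case using pCons.IH G by blast
qed

lemma expansion_is_expansion:
  fixes q f :: "'k::field poly"
  assumes "degree q > 0"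
  shows "is_expansion q f (expansion q f)"
  unfolding expansion_def
  using is_expansion_exists[OF assms] is_expansion_unique by (metis theI)

definition truncation ::
    "('k::field poly \<Rightarrow> 'g::linorder extended) \<Rightarrow> 'k poly \<Rightarrow> 'k poly \<Rightarrow> 'g extended" where
  "truncation \<nu> q f =
     (let F = expansion q f in Min ((\<lambda>j. \<nu> (coeff F j * q ^ j)) ` {..degree F}))"

definition complete_set :: "('k::field poly \<Rightarrow> 'g::linorder extended) \<Rightarrow> 'k poly set \<Rightarrow> bool" where
  "complete_set \<nu> S \<longleftrightarrow>
     (\<forall>q\<in>S. degree q > 0) \<and>
     (\<forall>f. degree f > 0 \<longrightarrow> (\<exists>q\<in>S. degree q \<le> degree f \<and> truncation \<nu> q f = \<nu> f))"


section \<open>Key polynomials\<close>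

text \<open>Here \<open>\<nu>b\<close> is a valuation on the polynomial ring over an algebraic closure of \<open>K\<close>.\<close>
definition epsilon ::
    "('k::field \<Rightarrow> 'c::alg_closed_field) \<Rightarrow> ('c poly \<Rightarrow> 'g::linorder extended) \<Rightarrow> 'k poly \<Rightarrow>
     'g extended" where
  "epsilon \<kappa> \<nu>b f = Max ((\<lambda>a. \<nu>b [:- a, 1:]) ` {a. poly (map_poly \<kappa> f) a = 0})"

definition key_polynomial ::
    "('k::field \<Rightarrow> 'c::alg_closed_field) \<Rightarrow> ('c poly \<Rightarrow> 'g::linorder extended) \<Rightarrow> 'k poly \<Rightarrow> bool" where
  "key_polynomial \<kappa> \<nu>b Q \<longleftrightarrow>
     lead_coeff Q = 1 \<and> degree Q > 0 \<and>
     (\<forall>f. degree f > 0 \<and> degree f < degree Q \<longrightarrow> epsilon \<kappa> \<nu>b f < epsilon \<kappa> \<nu>b Q)"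

definition complete_sequence_of_key_polynomials ::
    "('k::field \<Rightarrow> 'c::alg_closed_field) \<Rightarrow> ('c poly \<Rightarrow> 'g::linorder extended) \<Rightarrow>
     ('k poly \<Rightarrow> 'g extended) \<Rightarrow> 'i::wellorder set \<Rightarrow> ('i \<Rightarrow> 'k poly) \<Rightarrow> bool" where
  "complete_sequence_of_key_polynomials \<kappa> \<nu>b \<nu> I Q \<longleftrightarrow>
     (\<forall>i\<in>I. key_polynomial \<kappa> \<nu>b (Q i)) \<and>
     strict_mono_on I (\<lambda>i. epsilon \<kappa> \<nu>b (Q i)) \<and> complete_set \<nu> (Q ` I)"

definition i_max :: "'i::wellorder set \<Rightarrow> 'i" where
  "i_max I = (GREATEST i. i \<in> I)"

definition I_star :: "'i::wellorder set \<Rightarrow> 'i set" where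
  "I_star I = I - {i_max I}"


section \<open>Degree classes\<close>

text \<open>
  \<open>n 1 < \<dots> < n (w + 1)\<close> are the degrees of the \<open>Q i\<close>, and \<open>deg_class Q n I q\<close> is \<open>I\<^sup>(\<^sup>q\<^sup>)\<close>.
  The index set \<open>I\<close> is always an argument: the notions below are used both for the initial
  family and for its subfamilies, with the same \<open>Q\<close>, \<open>n\<close> and \<open>w\<close>.
\<close>
definition deg_class ::
    "('i \<Rightarrow> 'k::zero poly) \<Rightarrow> (nat \<Rightarrow> nat) \<Rightarrow> 'i::wellorder set \<Rightarrow> nat \<Rightarrow> 'i set" where
  "deg_class Q n I q = {i\<in>I. degree (Q i) = n q}"

definition class_index ::
    "('i \<Rightarrow> 'k::zero poly) \<Rightarrow> (nat \<Rightarrow> nat) \<Rightarrow> nat \<Rightarrow> 'i \<Rightarrow> nat" where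
  "class_index Q n w i = (THE q. q \<in> {1..w + 1} \<and> degree (Q i) = n q)"

definition class_of ::
    "('i \<Rightarrow> 'k::zero poly) \<Rightarrow> (nat \<Rightarrow> nat) \<Rightarrow> nat \<Rightarrow> 'i::wellorder set \<Rightarrow> 'i \<Rightarrow> 'i set" where
  "class_of Q n w I i = deg_class Q n I (class_index Q n w i)"

text \<open>\<open>(deg Q\<^sub>i)\<^sub>+\<close>\<close>
definition next_degree ::
    "('i \<Rightarrow> 'k::zero poly) \<Rightarrow> (nat \<Rightarrow> nat) \<Rightarrow> nat \<Rightarrow> 'i \<Rightarrow> nat" where
  "next_degree Q n w i = n (class_index Q n w i + 1)"

text \<open>\<open>i - \<ell>\<^sub>q\<close> for \<open>i\<close> in the class \<open>I\<^sup>(\<^sup>q\<^sup>)\<close>\<close>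
definition position ::
    "('i \<Rightarrow> 'k::zero poly) \<Rightarrow> (nat \<Rightarrow> nat) \<Rightarrow> nat \<Rightarrow> 'i::wellorder set \<Rightarrow> 'i \<Rightarrow> nat" where
  "position Q n w I i = card {k \<in> class_of Q n w I i. k < i}"

definition singleton_or_nat :: "'i::wellorder set \<Rightarrow> bool" where
  "singleton_or_nat X \<longleftrightarrow>
     (\<exists>i. X = {i}) \<or> (\<exists>\<phi> :: nat \<Rightarrow> 'i. strict_mono \<phi> \<and> range \<phi> = X)"


section \<open>Successors and neat pairs\<close>

definition immediate_successor :: "'i::wellorder set \<Rightarrow> 'i \<Rightarrow> 'i \<Rightarrow> bool" where
  "immediate_successor I i l \<longleftrightarrow>
     i \<in> I \<and> l \<in> I \<and> i < l \<and> \<not> (\<exists>k\<in>I. i < k \<and> k < l)"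

definition less_succ ::
    "('i \<Rightarrow> 'k::zero poly) \<Rightarrow> (nat \<Rightarrow> nat) \<Rightarrow> nat \<Rightarrow> 'i::wellorder set \<Rightarrow> 'i \<Rightarrow> 'i \<Rightarrow> bool" where
  "less_succ Q n w I i l \<longleftrightarrow>
     i \<in> I \<and> l \<in> I \<and> i < l \<and>
     (immediate_successor I i l \<or>
      infinite (class_of Q n w I i) \<and> class_index Q n w l = class_index Q n w i + 1)"

definition pair_level ::
    "('i \<Rightarrow> 'k::zero poly) \<Rightarrow> (nat \<Rightarrow> nat) \<Rightarrow> nat \<Rightarrow> 'i::wellorder set \<Rightarrow> 'i \<Rightarrow> 'i \<Rightarrow> nat" where
  "pair_level Q n w I l i =
     (if immediate_successor I i l then position Q n w I i
      else max (position Q n w I i) (position Q n w I l))"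

definition neat_pair ::
    "('i \<Rightarrow> 'k::zero poly) \<Rightarrow> (nat \<Rightarrow> nat) \<Rightarrow> nat \<Rightarrow> 'i::wellorder set \<Rightarrow> 'i \<Rightarrow> 'i \<Rightarrow> bool" where
  "neat_pair Q n w I l i \<longleftrightarrow>
     less_succ Q n w I i l \<and>
     (class_index Q n w i \<noteq> class_index Q n w l \<and>
      infinite (class_of Q n w I i) \<and> infinite (class_of Q n w I l) \<longrightarrow>
      position Q n w I i = position Q n w I l)"

definition strongly_monic ::
    "('k::field poly \<Rightarrow> 'g::linorder extended) \<Rightarrow> 'k poly \<Rightarrow> 'k poly \<Rightarrow> bool" where
  "strongly_monic \<nu> q f \<longleftrightarrow>
     (let F = expansion q f in lead_coeff F = 1 \<and> \<nu> (q ^ degree F) = truncation \<nu> q f)"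

definition successively_strongly_monic ::
    "('k::field poly \<Rightarrow> 'g::linorder extended) \<Rightarrow> ('i \<Rightarrow> 'k poly) \<Rightarrow> (nat \<Rightarrow> nat) \<Rightarrow> nat \<Rightarrow>
     'i::wellorder set \<Rightarrow> bool" where
  "successively_strongly_monic \<nu> Q n w I \<longleftrightarrow>
     (\<forall>i\<in>I_star I. \<forall>l\<in>I_star I. less_succ Q n w I i l \<longrightarrow> strongly_monic \<nu> (Q i) (Q l))"


section \<open>Full expansions\<close>

text \<open>
  An expression \<open>\<Sum>\<^sub>j b\<^sub>j Qt\<^sup>\<lambda>\<^sup>j\<close> is the list of the pairs \<open>(b\<^sub>j, \<lambda>\<^sub>j)\<close>, where \<open>Qt\<close> is the
  family of the rescaled key polynomials \<open>Q\<^sub>i / a\<^sub>i\<close>.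
\<close>
type_synonym ('i, 'k) expr = "('k \<times> ('i \<Rightarrow>\<^sub>0 nat)) list"

definition Qt_power :: "('i \<Rightarrow> 'k::field poly) \<Rightarrow> ('i \<Rightarrow>\<^sub>0 nat) \<Rightarrow> 'k poly" where
  "Qt_power Qt \<mu> = (\<Prod>k\<in>Poly_Mapping.keys \<mu>. Qt k ^ poly_mapping.lookup \<mu> k)"

definition expr_value :: "('i \<Rightarrow> 'k::field poly) \<Rightarrow> ('i, 'k) expr \<Rightarrow> 'k poly" where
  "expr_value Qt e = (\<Sum>(b, \<mu>)\<leftarrow>e. smult b (Qt_power Qt \<mu>))"

definition appears :: "('i, 'k) expr \<Rightarrow> 'i \<Rightarrow> bool" where
  "appears e k \<longleftrightarrow> (\<exists>(b, \<mu>)\<in>set e. poly_mapping.lookup \<mu> k > 0)"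

definition full_expansion ::
    "('k::field \<Rightarrow> 'g::linorder extended) \<Rightarrow> ('k poly \<Rightarrow> 'g extended) \<Rightarrow>
     ('i \<Rightarrow> 'k poly) \<Rightarrow> ('i \<Rightarrow> 'k poly) \<Rightarrow> (nat \<Rightarrow> nat) \<Rightarrow> nat \<Rightarrow> 'i::wellorder set \<Rightarrow>
     'i \<Rightarrow> 'k poly \<Rightarrow> ('i, 'k) expr \<Rightarrow> bool" where
  "full_expansion vK \<nu> Q Qt n w I i f e \<longleftrightarrow>
     i \<in> I_star I \<and> f \<noteq> 0 \<and> e \<noteq> [] \<and> f = expr_value Qt e \<and>
     (\<forall>(b, \<mu>)\<in>set e. Poly_Mapping.keys \<mu> \<subseteq> {k\<in>I. k \<le> i}) \<and>
     truncation \<nu> (Q i) f = Min ((\<lambda>(b, \<mu>). vK b) ` set e) \<and>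
     (\<forall>(b, \<mu>)\<in>set e. \<forall>k\<in>I. k < i \<longrightarrow>
        real (poly_mapping.lookup \<mu> k) < real (next_degree Q n w k) / real (degree (Q k))) \<and>
     (\<forall>q\<in>{1..w}. \<forall>k\<in>deg_class Q n I q. \<forall>k'\<in>deg_class Q n I q.
        appears e k \<and> appears e k' \<longrightarrow> k = k')"

text \<open>\<open>j(f, q)\<close>, with \<open>None\<close> in place of \<open>-\<infinity>\<close>\<close>
definition j_index ::
    "('i \<Rightarrow> 'k::field poly) \<Rightarrow> (nat \<Rightarrow> nat) \<Rightarrow> 'i::wellorder set \<Rightarrow> ('i, 'k) expr \<Rightarrow> nat \<Rightarrow>
     'i option" where
  "j_index Q n I e q =
     (if \<exists>k\<in>deg_class Q n I q. appears e k
      then Some (THE k. k \<in> deg_class Q n I q \<and> appears e k) else None)"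

definition infinite_classes_used ::
    "('i \<Rightarrow> 'k::field poly) \<Rightarrow> (nat \<Rightarrow> nat) \<Rightarrow> nat \<Rightarrow> 'i::wellorder set \<Rightarrow> ('i, 'k) expr \<Rightarrow>
     nat set" where
  "infinite_classes_used Q n w I e =
     {q\<in>{1..w}. infinite (deg_class Q n I q) \<and> j_index Q n I e q \<noteq> None}"

definition neat_of_level ::
    "('i \<Rightarrow> 'k::field poly) \<Rightarrow> (nat \<Rightarrow> nat) \<Rightarrow> nat \<Rightarrow> 'i::wellorder set \<Rightarrow> ('i, 'k) expr \<Rightarrow>
     nat \<Rightarrow> bool" where
  "neat_of_level Q n w I e s \<longleftrightarrow>
     (\<forall>q\<in>infinite_classes_used Q n w I e. position Q n w I (the (j_index Q n I e q)) = s) \<and>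
     (infinite_classes_used Q n w I e = {} \<longrightarrow> s = 0)"

end

theory Submission
  imports Defs
begin

text \<open>
  Let \<open>a\<close> be a root of a key polynomial \<open>Q\<close> with \<open>\<nu>b (x - a) = \<epsilon>(Q)\<close>. Polynomials of degree less
  than \<open>deg Q\<close> have all their roots farther from the generic point than \<open>a\<close>, so their value is the
  value of the constant \<open>f(a)\<close>. Hence a product of two of them has the same value as its remainder
  modulo \<open>Q\<close>, which makes the truncation at \<open>Q\<close> supermultiplicative, and truncations grow with
  \<open>\<epsilon>(Q)\<close>. Together with completeness, the truncations at the elements of \<open>I\<^sup>(\<^sup>q\<^sup>)\<close> eventually agree
  with \<open>\<nu>\<close> on any finite set of polynomials of degree less than \<open>n (q + 1)\<close>.

  A neat pair \<open>(l, i)\<close> of level \<open>s\<close> always has \<open>i\<close> at position \<open>s\<close> in its class, so for given \<open>i\<close>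
  there are at most two such \<open>l\<close>. One thins out the classes from the top down: the element at
  position \<open>s\<close> of a class is chosen so late that its truncation computes \<open>\<nu>\<close> on the finitely many
  coefficients produced by the expansions of level \<open>s\<close> in the higher classes. Expanding repeatedly in
  the elements at position \<open>s\<close> of the lower classes gives the expansions that are sought.
\<close>

section \<open>Valuations and expansions\<close>

lemma valuation_zero: "valuation v \<Longrightarrow> v 0 = \<infinity>"
  and valuation_one: "valuation v \<Longrightarrow> v 1 = 0"
  and valuation_mult: "valuation v \<Longrightarrow> v (x * y) = v x + v y"
  and valuation_add: "valuation v \<Longrightarrow> min (v x) (v y) \<le> v (x + y)"
  and valuation_not_Minf: "valuation v \<Longrightarrow> v x \<noteq> -\<infinity>"
  by (auto simp: valuation_def)

text \<open>Doubling \<open>v (- 1)\<close> gives \<open>v 1 = 0\<close>, and an ordered group has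
  no torsion.\<close>

lemma valuation_uminus:
  assumes v: "valuation v"
  shows "v (- x) = v x"
proof -
  have "v (- 1) + v (- 1) = 0"
    using valuation_mult[OF v, of "- 1" "- 1"] valuation_one[OF v] by simp
  then have "v (- 1) = 0"
    by (cases "v (- 1)") (auto simp: zero_extended_def)
  then show ?thesis
    using valuation_mult[OF v, of "- 1" x] by simp
qed

lemma valuation_diff:
  assumes v: "valuation v"
  shows "min (v x) (v y) \<le> v (x - y)"
  using valuation_add[OF v, of x "- y"] by (simp add: valuation_uminus[OF v])

text \<open>The upper bound comes from writing x as (x - y) + y, where \<open>v y\<close> is too
  large to be the minimum.\<close>

lemma valuation_diff_eq:
  assumes v: "valuation v" and less: "v x < v y"
  shows "v (x - y) = v x"
proof (rule antisym)
  show "v x \<le> v (x - y)"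
    using valuation_diff[OF v, of x y] less by (simp add: min_def split: if_splits)
  have "min (v (x - y)) (v y) \<le> v x"
    using valuation_add[OF v, of "x - y" y] by simp
  then show "v (x - y) \<le> v x"
    using less by (auto simp: min_def split: if_splits)
qed

lemma valuation_sum:
  assumes v: "valuation v" and "\<And>i. i \<in> A \<Longrightarrow> m \<le> v (f i)"
  shows "m \<le> v (sum f A)"
  using assms(2)
proof (induction A rule: infinite_finite_induct)
  case (insert i A)
  then have "m \<le> min (v (f i)) (v (sum f A))" by simp
  also have "\<dots> \<le> v (f i + sum f A)" by (rule valuation_add[OF v])
  finally show ?case using insert by simp
qed (simp_all add: valuation_zero[OF v])

section \<open>Field embeddings acting on polynomials\<close>

lemma field_embedding_zero: "field_embedding \<iota> \<Longrightarrow> \<iota> 0 = 0"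
  unfolding field_embedding_def by (metis add_cancel_right_right)

lemma field_embedding_sum:
  assumes "field_embedding \<iota>"
  shows "\<iota> (sum f A) = (\<Sum>i\<in>A. \<iota> (f i))"
  by (induction A rule: infinite_finite_induct)
    (use assms in \<open>auto simp: field_embedding_zero field_embedding_def\<close>)

lemma field_embedding_eq_0_iff:
  assumes "field_embedding \<iota>"
  shows "\<iota> x = 0 \<longleftrightarrow> x = 0"
proof
  assume 0: "\<iota> x = 0"
  show "x = 0"
  proof (rule ccontr)
    assume "x \<noteq> 0"
    then have "\<iota> (x * inverse x) = 1" using assms by (simp add: field_embedding_def)
    then show False using assms 0 by (simp add: field_embedding_def)
  qed
qed (simp add: field_embedding_zero assms)

lemma map_poly_embedding_add:
  assumes "field_embedding \<iota>"
  shows "map_poly \<iota> (p + q) = map_poly \<iota> p + map_poly \<iota> q"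
  by (rule poly_eqI)
    (use assms in \<open>simp add: coeff_map_poly field_embedding_zero, simp add: field_embedding_def\<close>)

lemma map_poly_embedding_mult:
  assumes "field_embedding \<iota>"
  shows "map_poly \<iota> (p * q) = map_poly \<iota> p * map_poly \<iota> q"
proof (rule poly_eqI)
  fix k
  have "\<iota> (\<Sum>i\<le>k. coeff p i * coeff q (k - i)) = (\<Sum>i\<le>k. \<iota> (coeff p i) * \<iota> (coeff q (k - i)))"
    unfolding field_embedding_sum[OF assms] using assms by (simp add: field_embedding_def)
  then show "coeff (map_poly \<iota> (p * q)) k = coeff (map_poly \<iota> p * map_poly \<iota> q) k"
    by (simp add: coeff_mult coeff_map_poly field_embedding_zero assms)
qed

lemma map_poly_embedding_1:
  assumes "field_embedding \<iota>"
  shows "map_poly \<iota> 1 = 1"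
  using assms field_embedding_zero[OF assms] by (simp add: map_poly_1' field_embedding_def)

section \<open>Expansions in powers of a polynomial, and truncations\<close>

lemma degree_mod_less_pos:
  fixes q :: "'k::field poly"
  assumes "degree q > 0"
  shows "degree (f mod q) < degree q"
  using assms by (metis degree_0 degree_mod_less' not_gr_zero)

lemma is_expansion_monom:
  assumes "degree r < degree q"
  shows "is_expansion q (r * q ^ k) (monom r k)"
  using assms by (auto simp: is_expansion_def poly_monom)

lemma is_expansion_add:
  assumes "is_expansion q f F" "is_expansion q h H"
  shows "is_expansion q (f + h) (F + H)"
  using assms by (auto simp: is_expansion_def degree_add_less)

lemma is_expansion_sum:
  assumes "is_expansion q f F"
  shows "f = (\<Sum>j\<le>degree F. coeff F j * q ^ j)"
  using assms by (simp add: is_expansion_def poly_altdef)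

lemma expansion_eq: "is_expansion q f F \<Longrightarrow> expansion q f = F"
  unfolding expansion_def using is_expansion_unique by blast

text \<open>All coefficients have degree below \<open>degree q\<close>, so the nonzero terms have
  pairwise different degrees and nothing cancels at the top. This later bounds the exponents in
  expansions.\<close>

lemma degree_eval_expansion:
  fixes q :: "'k::field poly"
  assumes "F \<noteq> 0" "\<And>j. degree (coeff F j) < degree q"
  shows "degree (poly F q) = degree (lead_coeff F) + degree F * degree q"
  using assms
proof (induction F)
  case (pCons c F)
  have c: "degree c < degree q" using pCons.prems(2)[of 0] by simp
  show ?case
  proof (cases "F = 0")
    case False
    have "degree (coeff F j) < degree q" for j using pCons.prems(2)[of "Suc j"] by simp
    then have IH: "degree (poly F q) = degree (lead_coeff F) + degree F * degree q"
      using pCons.IH False by blast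
    have "is_expansion q (poly F q) F"
      using \<open>\<And>j. degree (coeff F j) < degree q\<close> by (simp add: is_expansion_def)
    \<comment> \<open>A zero value would make \<open>F\<close> a second expansion of 0; the degree
      formula for the product needs this excluded.\<close>
    then have "poly F q \<noteq> 0"
      using False is_expansion_unique[of q 0 F 0] c by (auto simp: is_expansion_def)
    then have deg: "degree (q * poly F q) = degree q + degree (poly F q)"
      using c by (intro degree_mult_eq) auto
    then have "degree (c + q * poly F q) = degree (q * poly F q)"
      using c by (intro degree_add_eq_right) simp
    then show ?thesis using False IH deg by simp
  qed simp
qed simp

text \<open>Coefficients beyond \<open>degree F\<close> vanish and have value \<infinity>, so the
  minimum over a finite range becomes a condition on all \<open>j\<close>. Sums of expansions can
  then be compared without tracking their degrees.\<close>

lemma le_truncation_iff: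
  assumes \<nu>: "valuation \<nu>" and F: "is_expansion q f F"
  shows "m \<le> truncation \<nu> q f \<longleftrightarrow> (\<forall>j. m \<le> \<nu> (coeff F j * q ^ j))"
proof -
  have "m \<le> truncation \<nu> q f \<longleftrightarrow> (\<forall>j\<le>degree F. m \<le> \<nu> (coeff F j * q ^ j))"
    unfolding truncation_def expansion_eq[OF F] by auto
  then show ?thesis
    by (metis coeff_eq_0 le_Pinf mult_zero_left not_le valuation_zero[OF \<nu>])
qed

lemma truncation_le_term:
  assumes "valuation \<nu>" "is_expansion q f F"
  shows "truncation \<nu> q f \<le> \<nu> (coeff F j * q ^ j)"
  using le_truncation_iff[OF assms] by blast

lemma truncation_le:
  assumes \<nu>: "valuation \<nu>" and q: "degree q > 0"
  shows "truncation \<nu> q f \<le> \<nu> f"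
proof -
  note F = expansion_is_expansion[OF q, of f]
  have "truncation \<nu> q f \<le> \<nu> (\<Sum>j\<le>degree (expansion q f). coeff (expansion q f) j * q ^ j)"
    by (intro valuation_sum[OF \<nu>] truncation_le_term[OF \<nu> F])
  then show ?thesis using is_expansion_sum[OF F] by simp
qed

lemma truncation_monom:
  assumes \<nu>: "valuation \<nu>" and r: "degree r < degree q"
  shows "truncation \<nu> q (r * q ^ k) = \<nu> (r * q ^ k)"
proof (rule antisym)
  show "truncation \<nu> q (r * q ^ k) \<le> \<nu> (r * q ^ k)"
    using r by (intro truncation_le[OF \<nu>]) simp
  show "\<nu> (r * q ^ k) \<le> truncation \<nu> q (r * q ^ k)"
    by (auto simp: le_truncation_iff[OF \<nu> is_expansion_monom[OF r]] valuation_zero[OF \<nu>])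
qed

lemma truncation_small:
  assumes "valuation \<nu>" "degree f < degree q"
  shows "truncation \<nu> q f = \<nu> f"
  using truncation_monom[OF assms, of 0] by simp

lemma truncation_add:
  assumes \<nu>: "valuation \<nu>" and q: "degree q > 0"
  shows "min (truncation \<nu> q f) (truncation \<nu> q h) \<le> truncation \<nu> q (f + h)"
proof -
  note F = expansion_is_expansion[OF q, of f] and H = expansion_is_expansion[OF q, of h]
  let ?m = "min (truncation \<nu> q f) (truncation \<nu> q h)"
  have "?m \<le> \<nu> (coeff (expansion q f + expansion q h) j * q ^ j)" for j
  proof -
    have "?m \<le> min (\<nu> (coeff (expansion q f) j * q ^ j)) (\<nu> (coeff (expansion q h) j * q ^ j))"
      by (intro min.mono truncation_le_term \<nu> F H)
    also have "\<dots> \<le> \<nu> (coeff (expansion q f) j * q ^ j + coeff (expansion q h) j * q ^ j)"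
      by (rule valuation_add[OF \<nu>])
    finally show ?thesis by (simp add: distrib_right)
  qed
  then show ?thesis
    by (simp add: le_truncation_iff[OF \<nu> is_expansion_add[OF F H]])
qed

lemma truncation_sum:
  assumes \<nu>: "valuation \<nu>" and q: "degree q > 0"
    and "\<And>i. i \<in> A \<Longrightarrow> m \<le> truncation \<nu> q (f i)"
  shows "m \<le> truncation \<nu> q (sum f A)"
  using assms(3)
proof (induction A rule: infinite_finite_induct)
  case (insert i A)
  then have "m \<le> min (truncation \<nu> q (f i)) (truncation \<nu> q (sum f A))" by simp
  also have "\<dots> \<le> truncation \<nu> q (f i + sum f A)" by (rule truncation_add[OF \<nu> q])
  finally show ?case using insert by simp
qed (use truncation_small[OF \<nu>, of 0 q] q in \<open>simp_all add: valuation_zero[OF \<nu>]\<close>)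

section \<open>Truncations at key polynomials\<close>

locale valuation_extension =
  fixes \<kappa> :: "'k::field \<Rightarrow> 'c::alg_closed_field"
    and \<nu>b :: "'c poly \<Rightarrow> 'g::linordered_ab_group_add extended"
    and \<nu> :: "'k poly \<Rightarrow> 'g extended"
  assumes embedding: "field_embedding \<kappa>"
    and nu_bar: "valuation \<nu>b"
    and extends: "\<nu>b (map_poly \<kappa> f) = \<nu> f"
begin

section \<open>The valuation on K[x] and roots in the algebraic closure\<close>

lemma valuation_nu: "valuation \<nu>"
  unfolding valuation_def extends[symmetric]
  by (simp add: map_poly_embedding_add[OF embedding] map_poly_embedding_mult[OF embedding]
      map_poly_embedding_1[OF embedding] valuation_zero[OF nu_bar] valuation_one[OF nu_bar]
      valuation_mult[OF nu_bar] valuation_add[OF nu_bar] valuation_not_Minf[OF nu_bar])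

abbreviation eval :: "'k poly \<Rightarrow> 'c \<Rightarrow> 'c" where
  "eval f \<equiv> poly (map_poly \<kappa> f)"

lemma finite_roots: "f \<noteq> 0 \<Longrightarrow> finite {b. eval f b = 0}"
  by (rule poly_roots_finite)
    (simp add: map_poly_eq_0_iff field_embedding_zero field_embedding_eq_0_iff embedding)

lemma degree_map_kappa: "degree (map_poly \<kappa> f) = degree f"
  by (cases "f = 0") (simp_all add: map_poly_degree_eq field_embedding_eq_0_iff embedding)

lemma root_le_epsilon:
  assumes "f \<noteq> 0" "eval f b = 0"
  shows "\<nu>b [:- b, 1:] \<le> epsilon \<kappa> \<nu>b f"
  unfolding epsilon_def using assms finite_roots by (intro Max_ge) auto

lemma epsilon_attained:
  assumes "degree f > 0"
  obtains a where "eval f a = 0" "\<nu>b [:- a, 1:] = epsilon \<kappa> \<nu>b f"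
proof -
  have "\<exists>a. eval f a = 0"
    using assms by (intro alg_closed_imp_poly_has_root) (simp add: degree_map_kappa)
  moreover have "finite {b. eval f b = 0}" using assms by (intro finite_roots) auto
  ultimately have "epsilon \<kappa> \<nu>b f \<in> (\<lambda>a. \<nu>b [:- a, 1:]) ` {a. eval f a = 0}"
    unfolding epsilon_def by (intro Max_in) auto
  then show ?thesis using that by auto
qed

section \<open>Reading the value of a polynomial off at a point of the closure\<close>

lemma const_mult: "\<nu>b [:x * y:] = \<nu>b [:x:] + \<nu>b [:y:]"
  using valuation_mult[OF nu_bar, of "[:x:]" "[:y:]"] by (simp add: mult.commute)

lemma value_smult: "\<nu>b (smult c p) = \<nu>b [:c:] + \<nu>b p"
  using valuation_mult[OF nu_bar, of "[:c:]" p] by simp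

text \<open>Evaluation at \<open>a\<close> turns each factor x - b into the constant a - b, so both
  sides are sums over \<open>A\<close> that are compared term by term.\<close>

lemma le_eval_split:
  assumes "\<And>b. b \<in># A \<Longrightarrow> \<nu>b [:- b, 1:] \<le> \<nu>b [:a - b:]"
  shows "\<nu>b (\<Prod>x\<in>#A. [:- x, 1:]) \<le> \<nu>b [:poly (\<Prod>x\<in>#A. [:- x, 1:]) a:]"
  using assms
proof (induction A)
  case (add x A)
  then have "\<nu>b [:- x, 1:] + \<nu>b (\<Prod>x\<in>#A. [:- x, 1:])
      \<le> \<nu>b [:a - x:] + \<nu>b [:poly (\<Prod>x\<in>#A. [:- x, 1:]) a:]"
    by (intro add_mono) auto
  then show ?case
    unfolding image_mset_add_mset prod_mset.add_mset poly_mult const_mult valuation_mult[OF nu_bar]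
    by simp
qed (simp add: one_pCons)

lemma eval_split:
  assumes "\<And>b. b \<in># A \<Longrightarrow> \<nu>b [:- b, 1:] = \<nu>b [:a - b:]"
  shows "\<nu>b (\<Prod>x\<in>#A. [:- x, 1:]) = \<nu>b [:poly (\<Prod>x\<in>#A. [:- x, 1:]) a:]"
  using assms
proof (induction A)
  case (add x A)
  then have "\<nu>b [:- x, 1:] + \<nu>b (\<Prod>x\<in>#A. [:- x, 1:])
      = \<nu>b [:a - x:] + \<nu>b [:poly (\<Prod>x\<in>#A. [:- x, 1:]) a:]"
    by simp
  then show ?case
    unfolding image_mset_add_mset prod_mset.add_mset poly_mult const_mult valuation_mult[OF nu_bar]
    by simp
qed (simp add: one_pCons)

lemma splitting:
  assumes "f \<noteq> 0"
  obtains A where "map_poly \<kappa> f = smult (\<kappa> (lead_coeff f)) (\<Prod>x\<in>#A. [:- x, 1:])"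
    "\<And>b. b \<in># A \<Longrightarrow> eval f b = 0"
proof -
  have "map_poly \<kappa> f \<noteq> 0"
    using assms by (simp add: map_poly_eq_0_iff field_embedding_zero field_embedding_eq_0_iff embedding)
  then obtain A where
    "map_poly \<kappa> f = smult (lead_coeff (map_poly \<kappa> f)) (\<Prod>x\<in>#A. [:- x, 1:])"
    using alg_closed_imp_factorization by blast
  moreover have "lead_coeff (map_poly \<kappa> f) = \<kappa> (lead_coeff f)"
    by (simp add: degree_map_kappa coeff_map_poly field_embedding_zero[OF embedding])
  ultimately have A: "map_poly \<kappa> f = smult (\<kappa> (lead_coeff f)) (\<Prod>x\<in>#A. [:- x, 1:])"
    by simp
  show ?thesis
  proof (rule that[OF A])
    fix b assume "b \<in># A"
    then show "eval f b = 0" unfolding A by (auto simp: poly_prod_mset)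
  qed
qed

text \<open>For a root b of \<open>f\<close> one has a - b = (x - b) - (x - a), and the value of x -
  b is at most that of x - a. Elements of the closure are valued as constant polynomials.\<close>

lemma le_value_at:
  assumes "degree f > 0" "epsilon \<kappa> \<nu>b f \<le> \<nu>b [:- a, 1:]"
  shows "\<nu> f \<le> \<nu>b [:eval f a:]"
proof -
  have "f \<noteq> 0" using assms by auto
  then obtain A where A: "map_poly \<kappa> f = smult (\<kappa> (lead_coeff f)) (\<Prod>x\<in>#A. [:- x, 1:])"
    "\<And>b. b \<in># A \<Longrightarrow> eval f b = 0"
    using splitting by blast
  have "\<nu>b [:- b, 1:] \<le> \<nu>b [:a - b:]" if "b \<in># A" for b
  proof -
    have "\<nu>b [:- b, 1:] \<le> \<nu>b [:- a, 1:]"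
      using root_le_epsilon[OF \<open>f \<noteq> 0\<close> A(2)[OF that]] assms by order
    then show ?thesis
      using valuation_diff[OF nu_bar, of "[:- b, 1:]" "[:- a, 1:]"] by (simp add: min_def)
  qed
  from le_eval_split[of A, OF this]
  have "\<nu>b [:\<kappa> (lead_coeff f):] + \<nu>b (\<Prod>x\<in>#A. [:- x, 1:])
      \<le> \<nu>b [:\<kappa> (lead_coeff f):] + \<nu>b [:poly (\<Prod>x\<in>#A. [:- x, 1:]) a:]"
    by (rule add_left_mono)
  then show ?thesis
    unfolding extends[symmetric] A(1) poly_smult const_mult value_smult.
qed

text \<open>With strict inequality each a - b has exactly the value of x - b. Constants are listed
  separately because \<open>epsilon\<close> is meaningful only for nonconstant polynomials.\<close>

lemma value_at:
  assumes "degree f = 0 \<or> epsilon \<kappa> \<nu>b f < \<nu>b [:- a, 1:]"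
  shows "\<nu> f = \<nu>b [:eval f a:]"
proof (cases "degree f = 0")
  case True
  then have "map_poly \<kappa> f = [:eval f a:]"
    by (auto elim!: degree_eq_zeroE simp: map_poly_pCons field_embedding_zero[OF embedding])
  then show ?thesis by (metis extends)
next
  case False
  then have "f \<noteq> 0" by auto
  then obtain A where A: "map_poly \<kappa> f = smult (\<kappa> (lead_coeff f)) (\<Prod>x\<in>#A. [:- x, 1:])"
    "\<And>b. b \<in># A \<Longrightarrow> eval f b = 0"
    using splitting by blast
  have "\<nu>b [:- b, 1:] = \<nu>b [:a - b:]" if "b \<in># A" for b
  proof -
    have "\<nu>b [:- b, 1:] < \<nu>b [:- a, 1:]"
      using root_le_epsilon[OF \<open>f \<noteq> 0\<close> A(2)[OF that]] assms False by simp
    then show ?thesis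
      using valuation_diff_eq[OF nu_bar, of "[:- b, 1:]" "[:- a, 1:]"] by simp
  qed
  from eval_split[of A, OF this]
  show ?thesis
    unfolding extends[symmetric] A(1) poly_smult const_mult value_smult
    by simp
qed

text \<open>If \<open>a\<close> is a root of \<open>Q\<close> of maximal \<open>\<nu>b (x - a)\<close>, then \<open>f h\<close> and its remainder
  modulo \<open>Q\<close> agree at \<open>a\<close>, where their values can be read off.\<close>
lemma value_mod_key_polynomial:
  assumes Q: "key_polynomial \<kappa> \<nu>b Q" and "degree f < degree Q" "degree h < degree Q"
  shows "\<nu> (f * h mod Q) = \<nu> (f * h)"
proof -
  have pos: "degree Q > 0" using Q by (simp add: key_polynomial_def)
  then obtain a where a: "eval Q a = 0" "\<nu>b [:- a, 1:] = epsilon \<kappa> \<nu>b Q"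
    using epsilon_attained by blast
  have at: "\<nu> p = \<nu>b [:eval p a:]" if "degree p < degree Q" for p
    using Q that by (intro value_at) (auto simp: a key_polynomial_def)
  have "degree (f * h mod Q) < degree Q"
    using pos by (rule degree_mod_less_pos)
  moreover have "eval (f * h mod Q) a = eval f a * eval h a"
  proof -
    have "eval (f * h) a = eval (f * h div Q * Q + f * h mod Q) a" by simp
    then show ?thesis
      unfolding map_poly_embedding_add[OF embedding] map_poly_embedding_mult[OF embedding]
      by (simp add: a)
  qed
  ultimately show ?thesis
    using assms(2,3) by (simp add: at const_mult valuation_mult[OF valuation_nu])
qed

text \<open>Multiplying two expansions gives terms p Q^k with p a product of two coefficients. The
  remainder of p modulo \<open>Q\<close> has the value of p, hence the part carried to Q^(k+1) has
  at least that value, and neither piece lowers the minimum.\<close>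

lemma truncation_mult:
  assumes Q: "key_polynomial \<kappa> \<nu>b Q"
  shows "truncation \<nu> Q f + truncation \<nu> Q h \<le> truncation \<nu> Q (f * h)"
proof -
  have pos: "degree Q > 0" using Q by (simp add: key_polynomial_def)
  define F H where "F = expansion Q f" and "H = expansion Q h"
  have F: "is_expansion Q f F" and H: "is_expansion Q h H"
    unfolding F_def H_def by (intro expansion_is_expansion pos)+
  have term_le: "truncation \<nu> Q f + truncation \<nu> Q h
      \<le> truncation \<nu> Q ((coeff F i * Q ^ i) * (coeff H j * Q ^ j))" for i j
  proof -
    let ?p = "coeff F i * coeff H j" and ?k = "i + j"
    have deg: "degree (coeff F i) < degree Q" "degree (coeff H j) < degree Q"
      using F H by (auto simp: is_expansion_def)
    have p: "?p * Q ^ ?k = (?p mod Q) * Q ^ ?k + (?p div Q) * Q ^ Suc ?k"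
      using arg_cong[OF mod_div_mult_eq[of ?p Q], of "\<lambda>x. x * Q ^ ?k"]
      by (simp only: distrib_right mult.assoc power_Suc)
    have r: "\<nu> (?p mod Q) = \<nu> ?p" by (rule value_mod_key_polynomial[OF Q deg])
    have "\<nu> ?p \<le> \<nu> (?p - ?p mod Q)"
      using valuation_diff[OF valuation_nu, of ?p "?p mod Q"] r by simp
    then have s: "\<nu> ?p \<le> \<nu> (?p div Q * Q)" by (simp add: minus_mod_eq_div_mult)
    have reorder: "(coeff F i * Q ^ i) * (coeff H j * Q ^ j) = ?p * Q ^ ?k"
      by (simp add: power_add mult.commute mult.left_commute)
    have "truncation \<nu> Q f + truncation \<nu> Q h \<le> \<nu> (coeff F i * Q ^ i) + \<nu> (coeff H j * Q ^ j)"
      by (intro add_mono truncation_le_term valuation_nu F H)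
    also have "\<dots> = \<nu> (?p * Q ^ ?k)"
      by (simp only: reorder flip: valuation_mult[OF valuation_nu])
    also have "\<dots> \<le> min (\<nu> ((?p mod Q) * Q ^ ?k)) (\<nu> ((?p div Q) * Q ^ Suc ?k))"
    proof -
      have "\<nu> (?p * Q ^ ?k) = \<nu> ((?p mod Q) * Q ^ ?k)"
        using r by (simp add: valuation_mult[OF valuation_nu])
      moreover have "\<nu> (?p * Q ^ ?k) \<le> \<nu> ((?p div Q * Q) * Q ^ ?k)"
        unfolding valuation_mult[OF valuation_nu, of _ "Q ^ ?k"] by (rule add_right_mono[OF s])
      ultimately show ?thesis by (simp add: mult.assoc)
    qed
    also have "\<dots> = min (truncation \<nu> Q ((?p mod Q) * Q ^ ?k)) (truncation \<nu> Q ((?p div Q) * Q ^ Suc ?k))"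
    proof -
      have "degree (?p mod Q) < degree Q" using pos by (rule degree_mod_less_pos)
      \<comment> \<open>The degree of \<open>?p\<close> is below twice that of \<open>Q\<close>, so
        a single carry already yields reduced coefficients.\<close>
      moreover have "degree (?p div Q) < degree Q"
      proof -
        have "degree ?p < degree Q + degree Q" using degree_mult_le[of "coeff F i" "coeff H j"] deg by linarith
        then have "degree (?p - ?p mod Q) < degree Q + degree Q"
          using degree_mod_less_pos[OF pos, of ?p] by (intro degree_diff_less) auto
        then have "degree (?p div Q * Q) < degree Q + degree Q"
          by (simp only: minus_mod_eq_div_mult)
        then show ?thesis
          using pos degree_mult_eq[of "?p div Q" Q] by (cases "?p div Q = 0"; cases "Q = 0") auto
      qed
      ultimately show ?thesis by (simp only: truncation_monom[OF valuation_nu])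
    qed
    also have "\<dots> \<le> truncation \<nu> Q (?p * Q ^ ?k)"
      unfolding p by (rule truncation_add[OF valuation_nu pos])
    finally show ?thesis by (simp only: reorder)
  qed
  have fh: "f * h = (\<Sum>i\<le>degree F. \<Sum>j\<le>degree H. (coeff F i * Q ^ i) * (coeff H j * Q ^ j))"
    unfolding sum_product[symmetric]
    by (rule arg_cong2[OF is_expansion_sum[OF F] is_expansion_sum[OF H], of times])
  show ?thesis
    unfolding fh by (intro truncation_sum valuation_nu pos term_le)
qed

text \<open>For equal degrees, \<open>Q\<close> is \<open>Q'\<close> plus some h of smaller degree.
  At an optimal root of \<open>Q'\<close> the polynomials \<open>Q\<close> and h agree, which bounds
  \<nu>(h), and hence \<nu>(Q'), from below by \<nu>(Q); these are the two terms of the expansion of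
  \<open>Q\<close> in \<open>Q'\<close>.\<close>

lemma truncation_key_polynomial:
  assumes Q: "key_polynomial \<kappa> \<nu>b Q" and Q': "key_polynomial \<kappa> \<nu>b Q'"
    and le: "epsilon \<kappa> \<nu>b Q \<le> epsilon \<kappa> \<nu>b Q'"
  shows "truncation \<nu> Q' Q = \<nu> Q"
proof (rule antisym)
  have pos: "degree Q > 0" "degree Q' > 0" using Q Q' by (auto simp: key_polynomial_def)
  then show "truncation \<nu> Q' Q \<le> \<nu> Q" by (intro truncation_le valuation_nu)
  show "\<nu> Q \<le> truncation \<nu> Q' Q"
  proof (cases "degree Q < degree Q'")
    case True
    then show ?thesis by (simp add: truncation_small[OF valuation_nu])
  next
    case False
    \<comment> \<open>A larger degree of \<open>Q\<close> would force a larger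
      \<open>epsilon\<close>, by the definition of key polynomials.\<close>
    moreover have "\<not> degree Q' < degree Q"
      using Q le pos unfolding key_polynomial_def by force
    ultimately have deg: "degree Q = degree Q'" by simp
    define h where "h = Q - Q'"
    have h: "degree h < degree Q'"
    proof (rule ccontr)
      assume "\<not> ?thesis"
      moreover have "degree h \<le> degree Q'" unfolding h_def using deg by (simp add: degree_diff_le)
      ultimately have dh: "degree h = degree Q'" by simp
      then have "lead_coeff h = 0"
        using Q Q' deg unfolding h_def key_polynomial_def by simp
      then show False using dh pos by (metis degree_0 leading_coeff_0_iff not_gr_zero)
    qed
    obtain a where a: "eval Q' a = 0" "\<nu>b [:- a, 1:] = epsilon \<kappa> \<nu>b Q'"
      using epsilon_attained[OF pos(2)] by blast
    have "eval Q a = eval (Q' + h) a" by (simp add: h_def)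
    then have "eval Q a = eval h a" by (simp add: map_poly_embedding_add[OF embedding] a)
    moreover have "\<nu> h = \<nu>b [:eval h a:]"
      using Q' h by (intro value_at) (auto simp: a key_polynomial_def)
    moreover have "\<nu> Q \<le> \<nu>b [:eval Q a:]"
      using pos le a by (intro le_value_at) auto
    ultimately have "\<nu> Q \<le> \<nu> h" by simp
    moreover from this have "\<nu> Q \<le> \<nu> (Q - h)"
      using valuation_diff[OF valuation_nu, of Q h] by simp
    then have "\<nu> Q \<le> \<nu> Q'" by (simp add: h_def)
    moreover have "min (truncation \<nu> Q' Q') (truncation \<nu> Q' h) \<le> truncation \<nu> Q' (Q' + h)"
      by (rule truncation_add[OF valuation_nu pos(2)])
    moreover have "truncation \<nu> Q' Q' = \<nu> Q'"
      using truncation_monom[OF valuation_nu, of 1 Q' 1] pos by simp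
    ultimately show ?thesis
      using truncation_small[OF valuation_nu h] by (auto simp: h_def min_def split: if_splits)
  qed
qed

text \<open>Truncation at \<open>Q'\<close> does not lower any term of the
  \<open>Q\<close>-expansion: the coefficients are already reduced modulo \<open>Q'\<close>, the
  preceding lemma handles \<open>Q\<close> itself, and supermultiplicativity does the rest.\<close>

lemma truncation_mono:
  assumes Q: "key_polynomial \<kappa> \<nu>b Q" and Q': "key_polynomial \<kappa> \<nu>b Q'"
    and le: "epsilon \<kappa> \<nu>b Q \<le> epsilon \<kappa> \<nu>b Q'"
  shows "truncation \<nu> Q f \<le> truncation \<nu> Q' f"
proof -
  have pos: "degree Q > 0" "degree Q' > 0" using Q Q' by (auto simp: key_polynomial_def)
  have "degree Q \<le> degree Q'"
    using Q le pos unfolding key_polynomial_def by force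
  define F where "F = expansion Q f"
  have F: "is_expansion Q f F" unfolding F_def by (rule expansion_is_expansion[OF pos(1)])
  have pow: "\<nu> (Q ^ j) \<le> truncation \<nu> Q' (Q ^ j)" for j
  proof (induction j)
    case 0
    then show ?case using truncation_small[OF valuation_nu, of 1 Q'] pos by simp
  next
    case (Suc j)
    have "\<nu> (Q ^ Suc j) = \<nu> Q + \<nu> (Q ^ j)" by (simp add: valuation_mult[OF valuation_nu])
    also have "\<dots> \<le> truncation \<nu> Q' Q + truncation \<nu> Q' (Q ^ j)"
      using Suc truncation_key_polynomial[OF assms] by (simp add: add_left_mono)
    also have "\<dots> \<le> truncation \<nu> Q' (Q ^ Suc j)" using truncation_mult[OF Q'] by simp
    finally show ?case .
  qed
  have "truncation \<nu> Q f \<le> truncation \<nu> Q' (coeff F j * Q ^ j)" for j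
  proof -
    have "degree (coeff F j) < degree Q'"
      using F \<open>degree Q \<le> degree Q'\<close> by (auto simp: is_expansion_def intro: less_le_trans)
    then have c: "truncation \<nu> Q' (coeff F j) = \<nu> (coeff F j)"
      by (rule truncation_small[OF valuation_nu])
    have "truncation \<nu> Q f \<le> \<nu> (coeff F j) + \<nu> (Q ^ j)"
      using truncation_le_term[OF valuation_nu F] by (simp add: valuation_mult[OF valuation_nu])
    also have "\<dots> \<le> truncation \<nu> Q' (coeff F j) + truncation \<nu> Q' (Q ^ j)"
      unfolding c by (rule add_left_mono[OF pow])
    also have "\<dots> \<le> truncation \<nu> Q' (coeff F j * Q ^ j)" by (rule truncation_mult[OF Q'])
    finally show ?thesis .
  qed
  then show ?thesis
    by (subst is_expansion_sum[OF F]) (intro truncation_sum valuation_nu pos)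
qed

end

section \<open>Expressions in the rescaled key polynomials\<close>

lemma Qt_power_superset:
  assumes "finite A" "Poly_Mapping.keys \<mu> \<subseteq> A"
  shows "Qt_power Qt \<mu> = (\<Prod>k\<in>A. Qt k ^ poly_mapping.lookup \<mu> k)"
  unfolding Qt_power_def
  by (rule prod.mono_neutral_left) (use assms in \<open>auto simp: not_in_keys_iff_lookup_eq_zero\<close>)

lemma Qt_power_add: "Qt_power Qt (\<mu> + \<mu>') = Qt_power Qt \<mu> * Qt_power Qt \<mu>'"
proof -
  let ?A = "Poly_Mapping.keys \<mu> \<union> Poly_Mapping.keys \<mu>'"
  have "Qt_power Qt (\<mu> + \<mu>') = (\<Prod>k\<in>?A. Qt k ^ poly_mapping.lookup (\<mu> + \<mu>') k)"
    using Poly_Mapping.keys_add[of \<mu> \<mu>'] by (intro Qt_power_superset) auto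
  also have "\<dots> = (\<Prod>k\<in>?A. Qt k ^ poly_mapping.lookup \<mu> k) * (\<Prod>k\<in>?A. Qt k ^ poly_mapping.lookup \<mu>' k)"
    by (simp add: lookup_add power_add prod.distrib)
  also have "\<dots> = Qt_power Qt \<mu> * Qt_power Qt \<mu>'"
    by (simp add: Qt_power_superset[of ?A])
  finally show ?thesis .
qed

lemma Qt_power_single: "Qt_power Qt (Poly_Mapping.single i j) = Qt i ^ j"
  by (subst Qt_power_superset[of "{i}"]) auto

lemma expr_value_Nil: "expr_value Qt [] = 0"
  and expr_value_Cons: "expr_value Qt ((b, \<mu>) # e) = smult b (Qt_power Qt \<mu>) + expr_value Qt e"
  and expr_value_append: "expr_value Qt (e @ e') = expr_value Qt e + expr_value Qt e'"
  by (simp_all add: expr_value_def)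

text \<open>Multiplication by the j-th power of the unscaled key polynomial, with the scaling factor
  \<open>a\<close> moved into the coefficients.\<close>

definition shift_expr :: "'i \<Rightarrow> 'k::field \<Rightarrow> nat \<Rightarrow> ('i, 'k) expr \<Rightarrow> ('i, 'k) expr" where
  "shift_expr i a j e = map (\<lambda>(b, \<mu>). (b * a ^ j, \<mu> + Poly_Mapping.single i j)) e"

lemma expr_value_shift:
  "expr_value Qt (shift_expr i a j e) = expr_value Qt e * smult a (Qt i) ^ j"
proof (induction e)
  case (Cons t e)
  then show ?case
    by (cases t)
      (simp add: shift_expr_def expr_value_Cons Qt_power_add Qt_power_single smult_power distrib_right
        smult_add_right mult.commute distrib_left)
qed (simp add: shift_expr_def expr_value_Nil)

lemma expr_value_concat:
  "expr_value Qt (concat (map E [0..<Suc m])) = (\<Sum>j\<le>m. expr_value Qt (E j))"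
  by (induction m) (simp_all add: expr_value_append expr_value_Nil add.commute)

text \<open>\<open>B k\<close> is the set of the exponents allowed for \<open>Qt k\<close>.\<close>
definition represents ::
    "('i \<Rightarrow> 'k::field poly) \<Rightarrow> ('k \<Rightarrow> 'g::linorder extended) \<Rightarrow> ('i \<Rightarrow> nat set) \<Rightarrow> 'k poly \<Rightarrow>
     'g extended \<Rightarrow> ('i, 'k) expr \<Rightarrow> bool" where
  "represents Qt vK B f m e \<longleftrightarrow>
     expr_value Qt e = f \<and> (\<forall>(b, \<mu>)\<in>set e. m \<le> vK b) \<and> (\<exists>(b, \<mu>)\<in>set e. vK b = m) \<and>
     (\<forall>(b, \<mu>)\<in>set e. \<forall>k. poly_mapping.lookup \<mu> k \<in> B k)"

lemma represents_mono:
  "represents Qt vK B f m e \<Longrightarrow> (\<And>k. B k \<subseteq> B' k) \<Longrightarrow> represents Qt vK B' f m e"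
  unfolding represents_def by fast

lemma represents_const:
  "represents Qt vK (\<lambda>_. {0}) [:b:] (vK b) [(b, 0)]"
  by (simp add: represents_def expr_value_Cons expr_value_Nil Qt_power_def)

lemma represents_Min:
  assumes "represents Qt vK B f m e"
  shows "Min ((\<lambda>(b, \<mu>). vK b) ` set e) = m"
  using assms unfolding represents_def by (intro Min_eqI) force+

text \<open>One step of the iterated expansion. Since a^j has the value of Q_i^j, absorbing it turns
  the coefficient values of \<open>E j\<close> into those of the term f_j Q_i^j, and the overall
  minimum is the truncation. As the expressions for the f_j avoid \<open>Qt i\<close>, its exponent
  is exactly j.\<close>

lemma represents_expansion:
  fixes \<nu> :: "'k::field poly \<Rightarrow> 'g::linordered_ab_group_add extended"
  assumes \<nu>: "valuation \<nu>" and vK: "\<And>c. vK c = \<nu> [:c:]"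
    and F: "is_expansion (Q i) f F"
    and a: "a \<noteq> 0" "Qt i = smult (inverse a) (Q i)" "vK a = \<nu> (Q i)"
    and B: "B i = {0}"
    and E: "\<And>j. represents Qt vK B (coeff F j) (\<nu> (coeff F j)) (E j)"
  shows "\<exists>e. represents Qt vK (B(i := {..degree F})) f (truncation \<nu> (Q i) f) e \<and>
    (degree F > 0 \<longrightarrow> appears e i)"
proof (intro exI conjI impI)
  define e where "e = concat (map (\<lambda>j. shift_expr i a j (E j)) [0..<Suc (degree F)])"
  have set_e: "(b', \<mu>') \<in> set e \<longleftrightarrow> (\<exists>j\<le>degree F. \<exists>(b, \<mu>)\<in>set (E j).
      b' = b * a ^ j \<and> \<mu>' = \<mu> + Poly_Mapping.single i j)" for b' \<mu>'
    unfolding e_def shift_expr_def by (auto simp: less_Suc_eq_le simp del: upt_Suc) force+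
  have pow: "\<nu> [:a ^ j:] = \<nu> (Q i ^ j)" for j
  proof (induction j)
    case (Suc j)
    have "\<nu> [:a ^ Suc j:] = \<nu> ([:a:] * [:a ^ j:])" by (simp add: mult.commute)
    then show ?case
      using Suc a(3) by (simp add: vK valuation_mult[OF \<nu>] del: mult_pCons_left mult_pCons_right)
  qed (simp flip: one_pCons)
  have v_shift: "vK (b * a ^ j) = vK b + \<nu> (Q i ^ j)" for b j
    using valuation_mult[OF \<nu>, of "[:b:]" "[:a ^ j:]"] by (simp add: vK pow mult.commute)
  have value_e: "expr_value Qt e = f"
  proof -
    have "smult a (Qt i) = Q i" using a by simp
    then show ?thesis
      using E unfolding e_def expr_value_concat expr_value_shift represents_def
      by (simp flip: is_expansion_sum[OF F])
  qed
  have le: "truncation \<nu> (Q i) f \<le> vK b'" if b': "(b', \<mu>') \<in> set e" for b' \<mu>'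
  proof -
    obtain j b \<mu> where j: "(b, \<mu>) \<in> set (E j)" "b' = b * a ^ j"
      using b' unfolding set_e by blast
    have "truncation \<nu> (Q i) f \<le> \<nu> (coeff F j) + \<nu> (Q i ^ j)"
      using truncation_le_term[OF \<nu> F] by (simp add: valuation_mult[OF \<nu>])
    also have "\<dots> \<le> vK b + \<nu> (Q i ^ j)"
      using E[of j] j by (intro add_right_mono) (auto simp: represents_def)
    finally show ?thesis using j v_shift by simp
  qed
  have attained: "\<exists>(b', \<mu>')\<in>set e. vK b' = truncation \<nu> (Q i) f"
  proof -
    have "truncation \<nu> (Q i) f \<in> (\<lambda>j. \<nu> (coeff F j * Q i ^ j)) ` {..degree F}"
      unfolding truncation_def expansion_eq[OF F] Let_def by (rule Min_in) auto
    then obtain j where j: "j \<le> degree F" "truncation \<nu> (Q i) f = \<nu> (coeff F j) + \<nu> (Q i ^ j)"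
      by (auto simp: valuation_mult[OF \<nu>])
    obtain b \<mu> where "(b, \<mu>) \<in> set (E j)" "vK b = \<nu> (coeff F j)"
      using E[of j] by (auto simp: represents_def)
    then have "(b * a ^ j, \<mu> + Poly_Mapping.single i j) \<in> set e"
      "vK (b * a ^ j) = truncation \<nu> (Q i) f"
      using j v_shift by (auto simp: set_e)
    then show ?thesis by blast
  qed
  have exponents: "poly_mapping.lookup \<mu>' k \<in> (B(i := {..degree F})) k" if mem: "(b', \<mu>') \<in> set e" for b' \<mu>' k
  proof -
    obtain j b \<mu> where j: "j \<le> degree F" "(b, \<mu>) \<in> set (E j)" "\<mu>' = \<mu> + Poly_Mapping.single i j"
      using mem unfolding set_e by blast
    have \<mu>: "poly_mapping.lookup \<mu> k \<in> B k"
      using E[of j] j(2) unfolding represents_def by blast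
    show ?thesis
    proof (cases "k = i")
      case True
      then show ?thesis using \<mu> B j(1) by (simp add: j(3) lookup_add)
    next
      case False
      then show ?thesis using \<mu> by (simp add: j(3) lookup_add lookup_single)
    qed
  qed
  show "represents Qt vK (B(i := {..degree F})) f (truncation \<nu> (Q i) f) e"
    unfolding represents_def using value_e le attained exponents by blast
  \<comment> \<open>The expression for the leading coefficient has at least one term, whose exponent
    at \<open>i\<close> becomes \<open>degree F\<close>.\<close>
  show "appears e i" if pos: "degree F > 0"
  proof -
    obtain b \<mu> where "(b, \<mu>) \<in> set (E (degree F))"
      using E[of "degree F"] by (auto simp: represents_def)
    then have "(b * a ^ degree F, \<mu> + Poly_Mapping.single i (degree F)) \<in> set e"
      by (auto simp: set_e)
    then show ?thesis
      unfolding appears_def using pos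
      by (intro bexI[of _ "(b * a ^ degree F, \<mu> + Poly_Mapping.single i (degree F))"])
        (auto simp: lookup_add)
  qed
qed

section \<open>Complete sequences of key polynomials\<close>

text \<open>The last rescaled member is only ever expanded, never a base of expansions, so
  \<open>Qt_last\<close> retains its degree.\<close>

locale key_family = valuation_extension \<kappa> \<nu>b \<nu>
  for \<kappa> :: "'k::field \<Rightarrow> 'c::alg_closed_field"
    and \<nu>b :: "'c poly \<Rightarrow> 'g::linordered_ab_group_add extended"
    and \<nu> :: "'k poly \<Rightarrow> 'g extended" +
  fixes I :: "'i::wellorder set"
    and Q Qt :: "'i \<Rightarrow> 'k poly"
    and a :: "'i \<Rightarrow> 'k"
    and n :: "nat \<Rightarrow> nat"
    and w :: nat
    and vK :: "'k \<Rightarrow> 'g extended"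
  assumes key: "complete_sequence_of_key_polynomials \<kappa> \<nu>b \<nu> I Q"
    and n_1: "n 1 = 1" and n_mono: "strict_mono_on {1..w + 1} n"
    and degrees: "(\<lambda>i. degree (Q i)) ` I = n ` {1..w + 1}"
    and classes: "q \<in> {1..w + 1} \<Longrightarrow> singleton_or_nat (deg_class Q n I q)"
    and last_class: "deg_class Q n I (w + 1) = {i_max I}"
    and vK: "vK c = \<nu> [:c:]"
    and a_nonzero: "i \<in> I_star I \<Longrightarrow> a i \<noteq> 0"
    and v_a: "i \<in> I_star I \<Longrightarrow> vK (a i) = \<nu> (Q i)"
    and Qt: "i \<in> I_star I \<Longrightarrow> Qt i = smult (inverse (a i)) (Q i)"
    and Qt_last: "degree (Qt (i_max I)) = n (w + 1)"
begin

section \<open>Degrees and the order of the index set\<close>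

lemma n_less: "q < q' \<Longrightarrow> 1 \<le> q \<Longrightarrow> q' \<le> w + 1 \<Longrightarrow> n q < n q'"
  using n_mono by (auto simp: strict_mono_on_def)

lemma n_pos: "1 \<le> q \<Longrightarrow> q \<le> w + 1 \<Longrightarrow> n q > 0"
  using n_less[of 1 q] n_1 by (cases "q = 1") auto

lemma n_inj: "1 \<le> q \<Longrightarrow> q \<le> w + 1 \<Longrightarrow> 1 \<le> q' \<Longrightarrow> q' \<le> w + 1 \<Longrightarrow> n q = n q' \<Longrightarrow> q = q'"
  using n_less[of q q'] n_less[of q' q] by (cases q q' rule: linorder_cases) auto

lemma key_Q: "i \<in> I \<Longrightarrow> key_polynomial \<kappa> \<nu>b (Q i)"
  and epsilon_mono: "i \<in> I \<Longrightarrow> j \<in> I \<Longrightarrow> i \<le> j \<Longrightarrow> epsilon \<kappa> \<nu>b (Q i) \<le> epsilon \<kappa> \<nu>b (Q j)"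
  using key unfolding complete_sequence_of_key_polynomials_def
  by (auto simp: strict_mono_on_def le_less)

lemma degree_Q_pos: "i \<in> I \<Longrightarrow> degree (Q i) > 0"
  using key_Q by (simp add: key_polynomial_def)

text \<open>A key polynomial of larger degree has larger \<open>epsilon\<close> by definition, and
  \<open>epsilon\<close> increases along \<open>I\<close>.\<close>

lemma degree_less_imp_less:
  assumes "i \<in> I" "j \<in> I" "degree (Q i) < degree (Q j)"
  shows "i < j"
proof (rule ccontr)
  assume "\<not> i < j"
  then have "epsilon \<kappa> \<nu>b (Q j) \<le> epsilon \<kappa> \<nu>b (Q i)" using assms epsilon_mono by simp
  moreover have "epsilon \<kappa> \<nu>b (Q i) < epsilon \<kappa> \<nu>b (Q j)"
    using key_Q[OF assms(2)] assms degree_Q_pos by (simp add: key_polynomial_def)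
  ultimately show False by simp
qed

lemma deg_class_nonempty: "q \<in> {1..w + 1} \<Longrightarrow> deg_class Q n I q \<noteq> {}"
  using classes by (fastforce simp: singleton_or_nat_def)

lemma class_subset_I_star:
  assumes "q \<in> {1..w}"
  shows "deg_class Q n I q \<subseteq> I_star I"
proof
  fix i assume i: "i \<in> deg_class Q n I q"
  have "i \<noteq> i_max I"
  proof
    assume "i = i_max I"
    then have "degree (Q i) = n (w + 1)" using last_class by (auto simp: deg_class_def)
    then show False using i n_less[of q "w + 1"] assms by (simp add: deg_class_def)
  qed
  then show "i \<in> I_star I" using i by (simp add: I_star_def deg_class_def)
qed

text \<open>Completeness yields one exact truncation at some Q_j of degree at most that of
  \<open>f\<close>, so j lies in class \<open>q\<close> or below. Monotonicity of truncations
  carries exactness to all later elements of class \<open>q\<close>.\<close>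

lemma truncation_eventually:
  assumes q: "q \<in> {1..w}" and f: "degree f < n (q + 1)"
  shows "\<exists>k0\<in>deg_class Q n I q. \<forall>k\<in>deg_class Q n I q. k0 \<le> k \<longrightarrow> truncation \<nu> (Q k) f = \<nu> f"
proof (cases "degree f = 0")
  case True
  then have "truncation \<nu> (Q k) f = \<nu> f" if "k \<in> I" for k
    using degree_Q_pos[OF that] by (intro truncation_small valuation_nu) simp
  then show ?thesis
    using deg_class_nonempty[of q] q by (auto simp: deg_class_def)
next
  case False
  then have "\<exists>q\<in>Q ` I. degree q \<le> degree f \<and> truncation \<nu> q f = \<nu> f"
    using key by (simp add: complete_sequence_of_key_polynomials_def complete_set_def del: bex_simps)
  then obtain j where j: "j \<in> I" "degree (Q j) \<le> degree f" "truncation \<nu> (Q j) f = \<nu> f"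
    by blast
  \<comment> \<open>The index \<open>j\<close> itself if it lies in the class; otherwise its degree
    is below \<open>n q\<close> and every element of the class lies above it.\<close>
  obtain k0 where k0: "k0 \<in> deg_class Q n I q" "j \<le> k0"
  proof (cases "degree (Q j) = n q")
    case True
    then show ?thesis using that[of j] j by (simp add: deg_class_def)
  next
    case False
    have "degree (Q j) \<in> n ` {1..w + 1}" using j(1) unfolding degrees[symmetric] by simp
    then obtain p where p: "p \<in> {1..w + 1}" "degree (Q j) = n p" by blast
    have "p < q"
    proof (rule ccontr)
      assume "\<not> p < q"
      then have "p \<ge> q + 1" using False p by (cases "p = q") auto
      then have "n (q + 1) \<le> n p" using n_less[of "q + 1" p] p by (cases "p = q + 1") auto
      then show False using j f p by simp
    qed
    then have "degree (Q j) < n q" using n_less[of p q] p q by simp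
    then show ?thesis
      using that deg_class_nonempty[of q] q degree_less_imp_less[OF j(1)]
      by (fastforce simp: deg_class_def)
  qed
  have "truncation \<nu> (Q k) f = \<nu> f" if k: "k \<in> deg_class Q n I q" "k0 \<le> k" for k
  proof (rule antisym)
    have kI: "k \<in> I" using k by (simp add: deg_class_def)
    show "truncation \<nu> (Q k) f \<le> \<nu> f"
      by (intro truncation_le valuation_nu degree_Q_pos kI)
    show "\<nu> f \<le> truncation \<nu> (Q k) f"
      unfolding j(3)[symmetric] using k k0 j kI by (intro truncation_mono key_Q epsilon_mono) auto
  qed
  then show ?thesis using k0 by blast
qed

lemma truncation_eventually_finite:
  assumes q: "q \<in> {1..w}" and "finite A" "\<And>f. f \<in> A \<Longrightarrow> degree f < n (q + 1)"
  shows "\<exists>k0\<in>deg_class Q n I q. \<forall>k\<in>deg_class Q n I q. k0 \<le> k \<longrightarrow>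
    (\<forall>f\<in>A. truncation \<nu> (Q k) f = \<nu> f)"
  using assms(2,3)
proof (induction A)
  case empty
  then show ?case using deg_class_nonempty[of q] q by auto
next
  case (insert f A)
  then obtain k1 where k1: "k1\<in>deg_class Q n I q"
    "\<forall>k\<in>deg_class Q n I q. k1 \<le> k \<longrightarrow> (\<forall>f\<in>A. truncation \<nu> (Q k) f = \<nu> f)"
    by auto
  obtain k2 where k2: "k2\<in>deg_class Q n I q"
    "\<forall>k\<in>deg_class Q n I q. k2 \<le> k \<longrightarrow> truncation \<nu> (Q k) f = \<nu> f"
    using truncation_eventually[OF q, of f] insert.prems by auto
  show ?case
    using k1 k2 by (intro bexI[of _ "max k1 k2"]) (auto simp: max_def)
qed

text \<open>An infinite class leaves room to pass the threshold of each \<open>P s\<close> while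
  increasing strictly; in a singleton the only element already is the threshold.\<close>

lemma select_in_class:
  assumes q: "q \<in> {1..w}" and P: "\<And>s. finite (P s)" "\<And>s f. f \<in> P s \<Longrightarrow> degree f < n (q + 1)"
  shows "\<exists>c :: nat \<Rightarrow> 'i. range c \<subseteq> deg_class Q n I q \<and>
    (infinite (deg_class Q n I q) \<longrightarrow> strict_mono c) \<and>
    (\<forall>s. \<forall>f\<in>P s. truncation \<nu> (Q (c s)) f = \<nu> f)"
proof -
  have "\<forall>s. \<exists>k0\<in>deg_class Q n I q. \<forall>k\<in>deg_class Q n I q. k0 \<le> k \<longrightarrow>
      (\<forall>f\<in>P s. truncation \<nu> (Q k) f = \<nu> f)"
    using truncation_eventually_finite[OF q] P by blast
  then obtain T where T: "\<And>s. T s \<in> deg_class Q n I q"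
    "\<And>s k f. k \<in> deg_class Q n I q \<Longrightarrow> T s \<le> k \<Longrightarrow> f \<in> P s \<Longrightarrow> truncation \<nu> (Q k) f = \<nu> f"
    by metis
  have "singleton_or_nat (deg_class Q n I q)" using classes q by simp
  then consider i where "deg_class Q n I q = {i}"
    | \<phi> :: "nat \<Rightarrow> 'i" where "strict_mono \<phi>" "range \<phi> = deg_class Q n I q"
    by (auto simp: singleton_or_nat_def)
  then show ?thesis
  proof cases
    case 1
    then show ?thesis using T by (intro exI[of _ T]) auto
  next
    case 2
    then have "\<forall>s. \<exists>t. T s = \<phi> t" using T(1) by (metis rangeE)
    then obtain t where t: "\<And>s. T s = \<phi> (t s)" by metis
    \<comment> \<open>The summand \<open>s\<close> makes \<open>h\<close> strictly increasing, and
      the sum makes it dominate \<open>t\<close>.\<close>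
    define h where "h s = s + (\<Sum>r\<le>s. t r)" for s
    have "strict_mono h" by (simp add: strict_mono_Suc_iff h_def)
    moreover have "T s \<le> \<phi> (h s)" for s
    proof -
      have "t s \<le> (\<Sum>r\<le>s. t r)" by (rule member_le_sum) auto
      then have "t s \<le> h s" by (simp add: h_def)
      then show ?thesis using 2 t by (simp add: strict_mono_less_eq)
    qed
    ultimately show ?thesis
      using 2 by (intro exI[of _ "\<phi> \<circ> h"]) (auto intro!: strict_mono_o T(2))
  qed
qed

end

lemma finite_range_coeff: "finite (range (coeff p))"
proof (rule finite_subset)
  show "range (coeff p) \<subseteq> insert 0 (coeff p ` {..degree p})"
    using coeff_eq_0[of p] by (force simp: not_le[symmetric])
qed simp

context key_family
begin

lemma represents_key_expansion:
  assumes i: "i \<in> I_star I" and F: "is_expansion (Q i) f F" and B: "B i = {0}"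
    and E: "\<And>j. \<exists>e. represents Qt vK B (coeff F j) (\<nu> (coeff F j)) e"
  obtains e where "represents Qt vK (B(i := {..degree F})) f (truncation \<nu> (Q i) f) e"
    "degree F > 0 \<Longrightarrow> appears e i"
proof -
  have "\<forall>j. \<exists>e. represents Qt vK B (coeff F j) (\<nu> (coeff F j)) e" using E by blast
  from choice[OF this] obtain e where
    e: "represents Qt vK B (coeff F j) (\<nu> (coeff F j)) (e j)" for j
    by blast
  have "\<exists>e. represents Qt vK (B(i := {..degree F})) f (truncation \<nu> (Q i) f) e \<and>
      (degree F > 0 \<longrightarrow> appears e i)"
    by (rule represents_expansion[where E = e])
      (fact valuation_nu vK F a_nonzero[OF i] Qt[OF i] v_a[OF i] B e)+
  then show ?thesis by (elim exE conjE) (rule that, simp_all)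
qed

end

section \<open>Thinning out the degree classes\<close>

text \<open>
  \<open>c q s\<close> is the element that gets position \<open>s\<close> in the \<open>q\<close>-th class (constant in \<open>s\<close> on singletons),
  and \<open>P q s\<close> contains the coefficients that occur in the classes above the \<open>q\<close>-th at level \<open>s\<close>.
\<close>
locale level_family = key_family \<kappa> \<nu>b \<nu> I Q Qt a n w vK
  for \<kappa> :: "'k::field \<Rightarrow> 'c::alg_closed_field"
    and \<nu>b :: "'c poly \<Rightarrow> 'g::linordered_ab_group_add extended"
    and \<nu> :: "'k poly \<Rightarrow> 'g extended"
    and I :: "'i::wellorder set"
    and Q Qt :: "'i \<Rightarrow> 'k poly"
    and a :: "'i \<Rightarrow> 'k"
    and n :: "nat \<Rightarrow> nat"
    and w :: nat
    and vK :: "'k \<Rightarrow> 'g extended" +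
  fixes c :: "nat \<Rightarrow> nat \<Rightarrow> 'i"
    and P :: "nat \<Rightarrow> nat \<Rightarrow> 'k poly set"
  assumes c_last: "c (w + 1) = (\<lambda>_. i_max I)"
    and c_class': "q \<in> {1..w} \<Longrightarrow> range (c q) \<subseteq> deg_class Q n I q"
    and c_mono: "q \<in> {1..w} \<Longrightarrow> infinite (deg_class Q n I q) \<Longrightarrow> strict_mono (c q)"
    and c_truncation: "q \<in> {1..w} \<Longrightarrow> f \<in> P q s \<Longrightarrow> truncation \<nu> (Q (c q s)) f = \<nu> f"
    and P_coeff: "q \<in> {1..w} \<Longrightarrow> f \<in> P q s \<union> {Qt (c q (s + 1)), Qt (c (q + 1) s)} \<Longrightarrow>
      coeff (expansion (Q (c q s)) f) j \<in> P (q - 1) s"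
    and P_degree: "q \<le> w \<Longrightarrow> f \<in> P q s \<Longrightarrow> degree f < n (q + 1)"

text \<open>The choice of \<open>c q\<close> depends on \<open>P q\<close>, while
  \<open>P (q - 1)\<close> is computed from \<open>P q\<close>, all of \<open>c q\<close> and
  \<open>c (q + 1)\<close>. Hence dependent choice descends through the classes, starting from the
  constant sequence \<open>i_max I\<close> and no coefficients. \<open>R\<close> is the invariant of
  a stage and \<open>S\<close> links consecutive stages.\<close>

lemma (in key_family) level_family_exists:
  "\<exists>c P. level_family \<kappa> \<nu>b \<nu> I Q Qt a n w vK c P"
proof -
  define R where "R = (\<lambda>d (C :: nat \<Rightarrow> 'i, P :: nat \<Rightarrow> 'k poly set).
    (d = 0 \<longrightarrow> C = (\<lambda>_. i_max I)) \<and>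
    (d \<le> w \<longrightarrow> (\<forall>s. finite (P s) \<and> (\<forall>f\<in>P s. degree f < n (w - d + 1)))))"
  define S where "S = (\<lambda>d (C :: nat \<Rightarrow> 'i, P) (C' :: nat \<Rightarrow> 'i, P'). d < w \<longrightarrow>
    range C' \<subseteq> deg_class Q n I (w - d) \<and>
    (infinite (deg_class Q n I (w - d)) \<longrightarrow> strict_mono C') \<and>
    (\<forall>s. \<forall>f\<in>P s. truncation \<nu> (Q (C' s)) f = \<nu> f) \<and>
    (\<forall>s. \<forall>f\<in>P s \<union> {Qt (C' (s + 1)), Qt (C s)}. range (coeff (expansion (Q (C' s)) f)) \<subseteq> P' s))"
  \<comment> \<open>step \<open>d\<close> of the recursion yields \<open>c (w + 1 - d)\<close> and \<open>P (w - d)\<close>\<close>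
  have "\<exists>x. \<forall>d. R d (x d) \<and> S d (x d) (x (Suc d))"
  proof (rule dependent_nat_choice)
    show "\<exists>x. R 0 x" by (rule exI[of _ "(\<lambda>_. i_max I, \<lambda>_. {})"]) (simp add: R_def)
  next
    fix x d assume R: "R d x"
    obtain C P where x: "x = (C, P)" by (cases x)
    show "\<exists>y. R (Suc d) y \<and> S d x y"
    proof (cases "d < w")
      case False
      \<comment> \<open>All \<open>w\<close> classes are exhausted, and the conditions are vacuous
        from here on.\<close>
      then show ?thesis by (intro exI[of _ x]) (auto simp: x R_def S_def)
    next
      case True
      then have q: "w - d \<in> {1..w}" by simp
      have P: "finite (P s)" "f \<in> P s \<Longrightarrow> degree f < n (w - d + 1)" for s f
        using R True by (auto simp: R_def x)
      obtain C' where C': "range C' \<subseteq> deg_class Q n I (w - d)"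
        "infinite (deg_class Q n I (w - d)) \<longrightarrow> strict_mono C'"
        "\<forall>s. \<forall>f\<in>P s. truncation \<nu> (Q (C' s)) f = \<nu> f"
        using select_in_class[OF q, of P] P by blast
      \<comment> \<open>Finitely many polynomials with finitely many coefficients each. Being
        reduced modulo a member of class w - d, they have degree below \<open>n (w - d)\<close>, the
        bound required at the next stage.\<close>
      define P' where "P' s = (\<Union>f\<in>P s \<union> {Qt (C' (s + 1)), Qt (C s)}.
        range (coeff (expansion (Q (C' s)) f)))" for s
      have "finite (P' s)" for s
        unfolding P'_def using P(1) by (auto intro: finite_range_coeff)
      moreover have "degree h < n (w - Suc d + 1)" if h: "h \<in> P' s" for s h
      proof -
        have C's: "C' s \<in> deg_class Q n I (w - d)" using C'(1) by auto
        then have "C' s \<in> I" by (simp add: deg_class_def)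
        then have "degree (Q (C' s)) > 0" by (rule degree_Q_pos)
        from expansion_is_expansion[OF this] have "degree h < degree (Q (C' s))"
          using h unfolding P'_def is_expansion_def by blast
        then show ?thesis using C's True by (simp add: deg_class_def Suc_diff_Suc)
      qed
      ultimately have "R (Suc d) (C', P')" by (simp add: R_def)
      moreover have "S d x (C', P')" using C' by (auto simp: S_def x P'_def)
      ultimately show ?thesis by blast
    qed
  qed
  then obtain x where x: "\<And>d. R d (x d)" "\<And>d. S d (x d) (x (Suc d))" by blast
  define c where "c q = fst (x (w + 1 - q))" for q
  define P where "P q = snd (x (w - q))" for q
  have c_P: "range (c q) \<subseteq> deg_class Q n I q \<and>
      (infinite (deg_class Q n I q) \<longrightarrow> strict_mono (c q)) \<and>
      (\<forall>s. \<forall>f\<in>P q s. truncation \<nu> (Q (c q s)) f = \<nu> f) \<and>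
      (\<forall>s. \<forall>f\<in>P q s \<union> {Qt (c q (s + 1)), Qt (c (q + 1) s)}.
        range (coeff (expansion (Q (c q s)) f)) \<subseteq> P (q - 1) s)" if q: "q \<in> {1..w}" for q
  proof -
    have "Suc (w - q) = w + 1 - q" "w - (w - q) = q" "w - q < w" "w - (q - 1) = w + 1 - q"
      "w + 1 - (q + 1) = w - q"
      using q by auto
    then show ?thesis
      using x(2)[of "w - q"] unfolding S_def c_def P_def case_prod_beta by simp
  qed
  have "level_family \<kappa> \<nu>b \<nu> I Q Qt a n w vK c P"
  proof (rule level_family.intro[OF key_family_axioms], rule level_family_axioms.intro)
    show "c (w + 1) = (\<lambda>_. i_max I)"
      using x(1)[of 0] by (simp add: c_def R_def case_prod_beta)
    show "coeff (expansion (Q (c q s)) f) j \<in> P (q - 1) s"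
      if "q \<in> {1..w}" "f \<in> P q s \<union> {Qt (c q (s + 1)), Qt (c (q + 1) s)}" for q f s j
      using c_P[OF that(1)] that(2) by blast
    show "degree f < n (q + 1)" if "q \<le> w" "f \<in> P q s" for q f s
      using x(1)[of "w - q"] that unfolding R_def P_def case_prod_beta by simp
  qed (use c_P in blast)+
  then show ?thesis by blast
qed

context level_family
begin

section \<open>Order and degrees of the selected elements\<close>

lemma c_class: "q \<in> {1..w + 1} \<Longrightarrow> c q s \<in> deg_class Q n I q"
  using c_class'[of q] c_last last_class by (cases "q = w + 1") auto

lemma c_in_I: "q \<in> {1..w + 1} \<Longrightarrow> c q s \<in> I"
  and degree_c: "q \<in> {1..w + 1} \<Longrightarrow> degree (Q (c q s)) = n q"
  using c_class[of q s] by (auto simp: deg_class_def)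

lemma c_I_star: "q \<in> {1..w} \<Longrightarrow> c q s \<in> I_star I"
  using c_class' class_subset_I_star by blast

lemma c_less: "q < q' \<Longrightarrow> q \<in> {1..w + 1} \<Longrightarrow> q' \<in> {1..w + 1} \<Longrightarrow> c q s < c q' s'"
  by (intro degree_less_imp_less c_in_I) (auto simp: degree_c n_less)

lemma c_eq_imp: "c q s = c q' s' \<Longrightarrow> q \<in> {1..w + 1} \<Longrightarrow> q' \<in> {1..w + 1} \<Longrightarrow> q = q'"
  using c_less[of q q' s s'] c_less[of q' q s' s] by (cases q q' rule: linorder_cases) auto

lemma degree_Qt_c:
  assumes "q \<in> {1..w + 1}"
  shows "degree (Qt (c q s)) = n q"
proof (cases "q = w + 1")
  case True
  then show ?thesis using Qt_last c_last by simp
next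
  case False
  then have "c q s \<in> I_star I" using assms c_I_star by simp
  then show ?thesis using assms by (simp add: Qt a_nonzero degree_c)
qed

lemma c_cases:
  assumes "q \<in> {1..w + 1}"
  obtains "strict_mono (c q)" "infinite (range (c q))" "infinite (deg_class Q n I q)"
  | "c q = (\<lambda>_. c q 0)" "finite (range (c q))" "deg_class Q n I q = {c q 0}"
proof -
  have "singleton_or_nat (deg_class Q n I q)" using assms classes by simp
  then consider i where "deg_class Q n I q = {i}"
    | \<phi> :: "nat \<Rightarrow> 'i" where "strict_mono \<phi>" "range \<phi> = deg_class Q n I q"
    by (auto simp: singleton_or_nat_def)
  then show ?thesis
  proof cases
    case 1
    then have ci: "c q = (\<lambda>_. i)" using c_class[OF assms] by auto
    show ?thesis by (rule that(2)) (simp_all add: ci 1)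
  next
    case 2
    then have inf: "infinite (deg_class Q n I q)"
      using finite_imageD[of \<phi> UNIV] strict_mono_imp_inj_on[of \<phi>] by auto
    then have "q \<noteq> w + 1" using last_class by auto
    then have "strict_mono (c q)" using c_mono inf assms by simp
    moreover from this have "infinite (range (c q))"
      using finite_imageD[of "c q" UNIV] strict_mono_imp_inj_on[of "c q"] by auto
    ultimately show ?thesis using that(1) inf by blast
  qed
qed

text \<open>Only the elements with parameter \<open>s\<close> in the first \<open>q\<close> classes
  may have a nonzero exponent; its bound is the quotient bound of \<open>full_expansion\<close>
  cleared of denominators.\<close>

definition exponents :: "nat \<Rightarrow> nat \<Rightarrow> 'i \<Rightarrow> nat set" where
  "exponents q s k = {m. m = 0 \<or> (\<exists>p\<in>{1..q}. k = c p s \<and> m * n p < n (p + 1))}"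

lemma exponents_c: "q < p \<Longrightarrow> p \<le> w + 1 \<Longrightarrow> exponents q s (c p s') = {0}"
  using c_eq_imp[of p s'] by (fastforce simp: exponents_def)

text \<open>Induction on the class: the truncation at \<open>c q s\<close> computes \<nu> on
  \<open>P q s\<close>, so expanding there loses nothing, and the coefficients fall into
  \<open>P (q - 1) s\<close>. Below the first class only constants remain, since
  \<open>n 1 = 1\<close>.\<close>

lemma represents_level:
  assumes "q \<le> w" "f \<in> P q s"
  shows "\<exists>e. represents Qt vK (exponents q s) f (\<nu> f) e"
  using assms
proof (induction q arbitrary: f)
  case 0
  then have "degree f = 0" using P_degree[of 0 f s] n_1 by simp
  then obtain b where f: "f = [:b:]" by (rule degree_eq_zeroE)
  have "exponents 0 s = (\<lambda>_. {0})" by (auto simp: exponents_def)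
  then show ?case using represents_const[of Qt vK b] unfolding f vK by auto
next
  case (Suc q)
  define i where "i = c (Suc q) s"
  define F where "F = expansion (Q i) f"
  have q: "Suc q \<in> {1..w}" using Suc.prems by simp
  then have i: "i \<in> I_star I" "degree (Q i) = n (Suc q)" using c_I_star degree_c by (auto simp: i_def)
  then have F: "is_expansion (Q i) f F"
    unfolding F_def using n_pos[of "Suc q"] q by (intro expansion_is_expansion) simp
  have E: "\<exists>e. represents Qt vK (exponents q s) (coeff F j) (\<nu> (coeff F j)) e" for j
    using P_coeff[OF q] Suc by (simp add: F_def i_def)
  have "exponents q s i = {0}" using exponents_c q by (simp add: i_def)
  from represents_key_expansion[where B = "exponents q s", OF i(1) F this E] obtain e where
    e: "represents Qt vK ((exponents q s)(i := {..degree F})) f (truncation \<nu> (Q i) f) e"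
    by blast
  \<comment> \<open>The product is at most \<open>degree f\<close>, which is below
    \<open>n (Suc q + 1)\<close> on \<open>P (Suc q) s\<close>.\<close>
  have "degree F * n (Suc q) < n (Suc q + 1)"
  proof (cases "F = 0")
    case False
    then have "degree F * n (Suc q) \<le> degree f"
      using degree_eval_expansion[of F "Q i"] F i by (simp add: is_expansion_def)
    then show ?thesis using P_degree[OF Suc.prems] by simp
  qed (use n_pos q in simp)
  then have "m * n (Suc q) < n (Suc q + 1)" if "m \<le> degree F" for m
    using that by (meson le_less_trans mult_le_mono1)
  then have "((exponents q s)(i := {..degree F})) k \<subseteq> exponents (Suc q) s k" for k
    by (auto simp: exponents_def i_def)
  then have "represents Qt vK (exponents (Suc q) s) f (truncation \<nu> (Q i) f) e"
    by (rule represents_mono[OF e])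
  then show ?case using c_truncation[OF q Suc.prems(2)] by (auto simp: i_def)
qed

text \<open>The outermost expansion: here the truncation itself is the prescribed minimum, and the
  exponent at the base \<open>c q s\<close> is unrestricted, as in a full expansion. The
  coefficients are covered by \<open>represents_level\<close>.\<close>

lemma represents_pair:
  assumes q: "q \<in> {1..w}" and f: "f \<in> {Qt (c q (s + 1)), Qt (c (q + 1) s)}"
  shows "\<exists>e. represents Qt vK ((exponents (q - 1) s)(c q s := UNIV)) f
    (truncation \<nu> (Q (c q s)) f) e \<and> appears e (c q s)"
proof -
  define i where "i = c q s"
  define F where "F = expansion (Q i) f"
  have i: "i \<in> I_star I" "degree (Q i) = n q" using c_I_star degree_c q by (auto simp: i_def)
  then have F: "is_expansion (Q i) f F"
    unfolding F_def using n_pos[of q] q by (intro expansion_is_expansion) simp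
  have E: "\<exists>e. represents Qt vK (exponents (q - 1) s) (coeff F j) (\<nu> (coeff F j)) e" for j
    using P_coeff[OF q] f q by (intro represents_level) (auto simp: F_def i_def)
  \<comment> \<open>A constant \<open>F\<close> would put \<open>f\<close> below degree
    \<open>n q\<close>. So the base really appears, which later settles the case of level 0.\<close>
  have "degree F > 0"
  proof (rule ccontr)
    assume "\<not> degree F > 0"
    then have "poly F (Q i) = coeff F 0" by (auto elim!: degree_eq_zeroE)
    then have "degree f < n q" using F i by (metis is_expansion_def)
    moreover have "n q \<le> degree f"
      using f q n_less[of q "q + 1"] by (auto simp: degree_Qt_c)
    ultimately show False by simp
  qed
  have "exponents (q - 1) s i = {0}" using exponents_c q by (simp add: i_def)
  from represents_key_expansion[where B = "exponents (q - 1) s", OF i(1) F this E] obtain e where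
    e: "represents Qt vK ((exponents (q - 1) s)(i := {..degree F})) f (truncation \<nu> (Q i) f) e"
    "appears e i"
    using \<open>degree F > 0\<close> by blast
  have "represents Qt vK ((exponents (q - 1) s)(i := UNIV)) f (truncation \<nu> (Q i) f) e"
    by (rule represents_mono[OF e(1)]) auto
  then show ?thesis using e(2) by (auto simp: i_def)
qed

section \<open>The thinned index set and its neat pairs\<close>

definition J :: "'i set" where
  "J = (\<Union>q\<in>{1..w}. range (c q)) \<union> {i_max I}"

text \<open>The largest index becomes the constant sequence of class \<open>w + 1\<close>, so that
  all classes can be treated alike.\<close>

lemma J_eq: "J = (\<Union>q\<in>{1..w + 1}. range (c q))"
  using c_last by (auto simp: J_def atLeastAtMostSuc_conv)

lemma deg_class_J: "q \<in> {1..w + 1} \<Longrightarrow> deg_class Q n J q = range (c q)"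
  unfolding J_eq deg_class_def using degree_c n_inj by fastforce

lemma class_index_c:
  assumes "q \<in> {1..w + 1}"
  shows "class_index Q n w (c q s) = q"
  unfolding class_index_def
  using assms n_inj by (intro the_equality) (auto simp: degree_c)

lemma class_of_J: "q \<in> {1..w + 1} \<Longrightarrow> class_of Q n w J (c q s) = range (c q)"
  by (simp only: class_of_def class_index_c deg_class_J)

text \<open>In an infinite class the elements below \<open>c q s\<close> are exactly the earlier
  terms; on a singleton the parameter \<open>s\<close> carries no information.\<close>

lemma position_J:
  assumes "q \<in> {1..w + 1}"
  shows "position Q n w J (c q s) = (if infinite (range (c q)) then s else 0)"
proof (cases rule: c_cases[OF assms])
  case 1
  then have "{k \<in> range (c q). k < c q s} = c q ` {..<s}"
    by (auto simp: strict_mono_less)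
  moreover have "card (c q ` {..<s}) = s"
    using 1 by (simp add: card_image strict_mono_imp_inj_on)
  ultimately show ?thesis unfolding position_def class_of_J[OF assms] using 1 by simp
next
  case 2
  then have "{k \<in> range (c q). k < c q s} = {}" by (metis (no_types, lifting) Collect_empty_eq less_irrefl rangeE)
  then show ?thesis unfolding position_def class_of_J[OF assms] using 2 by simp
qed

lemma i_max_J: "i_max J = i_max I"
proof -
  have "i \<le> i_max I" if "i \<in> J" for i
    using that c_less[of _ "w + 1"] c_last by (fastforce simp: J_def intro: less_imp_le)
  then show ?thesis unfolding i_max_def[of J] by (intro Greatest_equality) (auto simp: J_def)
qed

lemma c_I_star_J: "q \<in> {1..w} \<Longrightarrow> c q s \<in> I_star J"
  unfolding I_star_def i_max_J using c_I_star[of q s] by (fastforce simp: I_star_def J_def)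

text \<open>In an infinite class the immediate successor is the next term; any other successor lies
  in the next class, at the same position by neatness or as its only element. A singleton class is
  followed by the first element of the next class. The level is always the parameter of
  \<open>i\<close>.\<close>

lemma neat_pair_cases:
  assumes neat: "neat_pair Q n w J l i"
  obtains q s where "q \<in> {1..w}" "i = c q s" "l = c q (s + 1) \<or> l = c (q + 1) s"
    "pair_level Q n w J l i = s" "finite (range (c q)) \<Longrightarrow> s = 0"
proof -
  have il: "i \<in> J" "l \<in> J" "i < l" using neat by (auto simp: neat_pair_def less_succ_def)
  obtain q r where q: "q \<in> {1..w + 1}" "i = c q r" using il(1) unfolding J_eq by blast
  obtain q' r' where q': "q' \<in> {1..w + 1}" "l = c q' r'" using il(2) unfolding J_eq by blast
  have "q \<le> q'" using c_less[of q' q r' r] il q q' by (cases "q' < q") auto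
  have "q \<noteq> w + 1" using il q q' \<open>q \<le> q'\<close> c_last by auto
  then have qw: "q \<in> {1..w}" "q + 1 \<in> {1..w + 1}" using q by auto
  have inJ: "c p s \<in> J" if "p \<in> {1..w + 1}" for p s unfolding J_eq using that by blast
  note index = class_index_c[OF q(1), of r, folded q(2)] class_index_c[OF q'(1), of r', folded q'(2)]
  note pos = position_J[OF q(1), of r, folded q(2)] position_J[OF q'(1), of r', folded q'(2)]
  note class_of = class_of_J[OF q(1), of r, folded q(2)] class_of_J[OF q'(1), of r', folded q'(2)]
  show ?thesis
  proof (cases rule: c_cases[OF q(1)])
    case inf: 1
    show ?thesis
    proof (cases "immediate_successor J i l")
      case True
      then have none: "\<not> (i < k \<and> k < l)" if "k \<in> J" for k
        using that by (auto simp: immediate_successor_def)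
      have "i < c q (r + 1)" using inf q by (simp add: strict_mono_less)
      then have "l \<le> c q (r + 1)" using none[OF inJ[OF q(1), of "r + 1"]] by force
      \<comment> \<open>Elements of later classes lie above \<open>c q (r + 1)\<close>.\<close>
      then have "q' = q" using c_less[of q q' "r + 1" r'] q q' \<open>q \<le> q'\<close> by (cases "q = q'") auto
      then have "r < r'" "r' \<le> r + 1"
        using il \<open>l \<le> c q (r + 1)\<close> q q' inf by (auto simp: strict_mono_less strict_mono_less_eq)
      then have "r' = r + 1" by simp
      then have "l = c q (r + 1)" using q' \<open>q' = q\<close> by simp
      then show ?thesis
        using that[OF qw(1) q(2)] True pos inf by (simp add: pair_level_def)
    next
      case False
      then have "q' = q + 1" using neat by (simp add: neat_pair_def less_succ_def index)
      have "l = c (q + 1) r \<and> pair_level Q n w J l i = r"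
      proof (cases rule: c_cases[OF q'(1)])
        case 1
        then have "r = r'" using neat \<open>q' = q + 1\<close> inf
          by (simp add: neat_pair_def index class_of pos)
        then show ?thesis using False q' \<open>q' = q + 1\<close> pos inf 1 by (simp add: pair_level_def)
      next
        case 2
        \<comment> \<open>The sequence of a singleton class is constant, so \<open>r\<close> may
          serve as parameter of \<open>l\<close>; the position 0 of \<open>l\<close> does not affect
          the maximum.\<close>
        then have "l = c (q + 1) r" using q' \<open>q' = q + 1\<close> by metis
        then show ?thesis using False pos inf 2 by (simp add: pair_level_def)
      qed
      then show ?thesis using that[OF qw(1) q(2)] inf by blast
    qed
  next
    case fin: 2
    then have i: "i = c q 0" using q by metis
    have imm: "immediate_successor J i l"
      using neat fin by (simp add: neat_pair_def less_succ_def class_of)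
    then have none: "\<not> (i < k \<and> k < l)" if "k \<in> J" for k
      using that by (auto simp: immediate_successor_def)
    have "q \<noteq> q'" using il q q' fin by (metis less_irrefl)
    then have "q < q'" using \<open>q \<le> q'\<close> by simp
    have "i < c (q + 1) 0" using c_less[of q "q + 1" r 0] q qw by simp
    then have le: "l \<le> c (q + 1) 0" using none[OF inJ[OF qw(2), of 0]] by force
    then have "q' = q + 1"
      using c_less[of "q + 1" q' 0 r'] q' qw \<open>q < q'\<close> by (cases "q' = q + 1") auto
    have "l = c (q + 1) 0"
    proof (cases rule: c_cases[OF q'(1)])
      case 1
      then have "r' = 0" using le q' \<open>q' = q + 1\<close> by (simp add: strict_mono_less_eq)
      then show ?thesis using q' \<open>q' = q + 1\<close> by simp
    next
      case 2
      then show ?thesis using q' \<open>q' = q + 1\<close> by metis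
    qed
    then show ?thesis
      using that[OF qw(1) i] imm pos fin by (simp add: pair_level_def)
  qed
qed

text \<open>Only elements \<open>c p s\<close> with p at most q appear, all with the same
  \<open>s\<close>. This gives at once the uniqueness within each class and the equality of all
  positions with the level.\<close>

lemma neat_full_expansion:
  assumes neat: "neat_pair Q n w J l i"
  shows "\<exists>e. full_expansion vK \<nu> Q Qt n w J i (Qt l) e \<and>
    neat_of_level Q n w J e (pair_level Q n w J l i)"
proof -
  obtain q s where q: "q \<in> {1..w}" and i: "i = c q s" and l: "l = c q (s + 1) \<or> l = c (q + 1) s"
    and level: "pair_level Q n w J l i = s" and fin: "finite (range (c q)) \<Longrightarrow> s = 0"
    using neat_pair_cases[OF neat] by blast
  have q1: "q \<in> {1..w + 1}" using q by simp
  obtain e where e: "represents Qt vK ((exponents (q - 1) s)(i := UNIV)) (Qt l)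
    (truncation \<nu> (Q i) (Qt l)) e" "appears e i"
    using represents_pair[OF q, of "Qt l" s] l i by blast
  have lookup: "m = 0 \<or> k = i \<or> (\<exists>p\<in>{1..q - 1}. k = c p s \<and> m * n p < n (p + 1))"
    if "(b, \<mu>) \<in> set e" "m = poly_mapping.lookup \<mu> k" for b \<mu> k m
  proof -
    have "m \<in> ((exponents (q - 1) s)(i := UNIV)) k"
      using e(1) that unfolding represents_def by blast
    then show ?thesis by (auto simp: exponents_def split: if_splits)
  qed
  have used: "\<exists>p\<in>{1..q}. k = c p s" if "(b, \<mu>) \<in> set e" "poly_mapping.lookup \<mu> k > 0" for b \<mu> k
    using lookup[OF that(1) refl, of k] that(2) q i by force
  then have appears_c: "\<exists>p\<in>{1..w}. k = c p s" if k: "appears e k" for k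
  proof -
    obtain b \<mu> where "(b, \<mu>) \<in> set e" "poly_mapping.lookup \<mu> k > 0"
      using k unfolding appears_def by auto
    from used[OF this] show ?thesis using q by auto
  qed
  have appears_class: "k = c p s" if k: "appears e k" "k \<in> deg_class Q n J p" "p \<in> {1..w}" for k p
  proof -
    obtain p' where "p' \<in> {1..w}" "k = c p' s" using appears_c[OF k(1)] by blast
    moreover have "k \<in> range (c p)" using k deg_class_J[of p] by simp
    ultimately show ?thesis using c_eq_imp[of p' s p] k by auto
  qed
  have "full_expansion vK \<nu> Q Qt n w J i (Qt l) e"
    unfolding full_expansion_def
  proof (intro conjI ballI impI)
    show "i \<in> I_star J" using c_I_star_J q i by simp
    have "degree (Qt l) > 0" using l q n_pos[of q] n_pos[of "q + 1"] by (auto simp: degree_Qt_c)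
    then show "Qt l \<noteq> 0" by auto
    show "e \<noteq> []" using e(2) by (auto simp: appears_def)
    show "Qt l = expr_value Qt e" using e(1) by (simp add: represents_def)
    show "truncation \<nu> (Q i) (Qt l) = Min ((\<lambda>(b, \<mu>). vK b) ` set e)"
      using represents_Min[OF e(1)] by simp
    have "Poly_Mapping.keys \<mu> \<subseteq> {k \<in> J. k \<le> i}" if t: "(b, \<mu>) \<in> set e" for b \<mu>
    proof
      fix k assume "k \<in> Poly_Mapping.keys \<mu>"
      then have "poly_mapping.lookup \<mu> k > 0" by (simp add: in_keys_iff)
      from used[OF t this] obtain p where p: "p \<in> {1..q}" "k = c p s" by blast
      then have "p \<in> {1..w + 1}" using q by simp
      then have "k \<in> J" unfolding J_eq using p(2) by blast
      moreover have "k \<le> i" using p i c_less[of p q s s] q by (cases "p = q") auto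
      ultimately show "k \<in> {k \<in> J. k \<le> i}" by simp
    qed
    then show "case t of (b, \<mu>) \<Rightarrow> Poly_Mapping.keys \<mu> \<subseteq> {k \<in> J. k \<le> i}" if "t \<in> set e" for t
      using that by (cases t) auto
    have "real (poly_mapping.lookup \<mu> k) < real (next_degree Q n w k) / real (degree (Q k))"
      if t: "(b, \<mu>) \<in> set e" and k: "k \<in> J" "k < i" for b \<mu> k
    proof -
      obtain p r where p: "p \<in> {1..w + 1}" "k = c p r" using k(1) unfolding J_eq by blast
      have "p \<noteq> w + 1" using c_less[of q "w + 1" s r] q p k(2) i by force
      then have pw: "p \<in> {1..w}" using p by simp
      have pos: "n p > 0" "n (p + 1) > 0" using n_pos pw by auto
      \<comment> \<open>If \<open>k\<close> is not the selected element of parameter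
        \<open>s\<close>, its exponent is 0; otherwise the bound comes from
        \<open>exponents\<close>.\<close>
      have "poly_mapping.lookup \<mu> k * n p < n (p + 1)"
      proof -
        have "k \<noteq> i" using k by simp
        then consider "poly_mapping.lookup \<mu> k = 0"
          | p' where "p' \<in> {1..q - 1}" "k = c p' s" "poly_mapping.lookup \<mu> k * n p' < n (p' + 1)"
          using lookup[OF t refl, of k] by metis
        then show ?thesis
        proof cases
          case 1
          then show ?thesis using pos by simp
        next
          case 2
          moreover have "p' \<in> {1..w + 1}" using 2 q by auto
          ultimately have "p' = p" using c_eq_imp[of p' s p r] p by simp
          then show ?thesis using 2 by simp
        qed
      qed
      then have "real (poly_mapping.lookup \<mu> k) * real (n p) < real (n (p + 1))"
        by (simp flip: of_nat_mult)
      then show ?thesis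
        using pos p by (simp add: next_degree_def class_index_c degree_c pos_less_divide_eq)
    qed
    then show "case t of (b, \<mu>) \<Rightarrow> \<forall>k\<in>J. k < i \<longrightarrow>
        real (poly_mapping.lookup \<mu> k) < real (next_degree Q n w k) / real (degree (Q k))"
      if "t \<in> set e" for t
      using that by (cases t) auto
    show "k = k'" if "p \<in> {1..w}" "k \<in> deg_class Q n J p" "k' \<in> deg_class Q n J p"
      "appears e k \<and> appears e k'" for p k k'
      using appears_class[of k p] appears_class[of k' p] that by simp
  qed
  moreover have "neat_of_level Q n w J e s"
    unfolding neat_of_level_def
  proof (intro conjI ballI impI)
    fix p assume "p \<in> infinite_classes_used Q n w J e"
    then have p: "p \<in> {1..w}" and inf: "infinite (deg_class Q n J p)"
      and ex: "\<exists>k\<in>deg_class Q n J p. appears e k"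
      by (auto simp: infinite_classes_used_def j_index_def split: if_splits)
    have "(THE k. k \<in> deg_class Q n J p \<and> appears e k) = c p s"
      using ex appears_class p by (intro the_equality) blast+
    then have "the (j_index Q n J e p) = c p s" using ex by (simp only: j_index_def if_True option.sel)
    then show "position Q n w J (the (j_index Q n J e p)) = s"
      using position_J[of p s] p inf deg_class_J[of p] by simp
  next
    \<comment> \<open>Level 0 is prescribed when no infinite class is used. Since
      \<open>c q s\<close> appears, class \<open>q\<close> is then a singleton, where
      \<open>s\<close> is 0.\<close>
    assume none: "infinite_classes_used Q n w J e = {}"
    have mem: "i \<in> deg_class Q n J q" unfolding deg_class_J[OF q1] i by blast
    have "finite (range (c q))"
    proof (rule ccontr)
      assume "infinite (range (c q))"
      then have "q \<in> infinite_classes_used Q n w J e"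
        unfolding infinite_classes_used_def j_index_def
        using q mem e(2) deg_class_J[OF q1] by auto
      then show False using none by simp
    qed
    then show "s = 0" by (rule fin)
  qed
  ultimately show ?thesis using level by auto
qed

text \<open>An infinite class and the sequence selected from it are both strictly enumerated by the
  natural numbers.\<close>

lemma eqpoll_class: "q \<in> {1..w} \<Longrightarrow> range (c q) \<approx> deg_class Q n I q"
proof -
  assume q: "q \<in> {1..w}"
  have nat: "(UNIV :: nat set) \<approx> range \<phi>" if "strict_mono \<phi>" for \<phi> :: "nat \<Rightarrow> 'i"
    using that unfolding eqpoll_def by (meson bij_betw_imageI strict_mono_imp_inj_on)
  have "q \<in> {1..w + 1}" using q by simp
  then show ?thesis
  proof (cases rule: c_cases)
    case 1
    have "singleton_or_nat (deg_class Q n I q)" using q classes by simp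
    then obtain \<phi> :: "nat \<Rightarrow> 'i" where "strict_mono \<phi>" "range \<phi> = deg_class Q n I q"
      using 1 by (auto simp: singleton_or_nat_def)
    then show ?thesis using nat[of \<phi>] nat[OF 1(1)] by (metis eqpoll_sym eqpoll_trans)
  next
    case 2
    then have "range (c q) = {c q 0}" by (metis range_constant image_cong)
    then show ?thesis using 2 by simp
  qed
qed

end

section \<open>Choosing the expansions for all neat pairs\<close>

theorem lemma4p3:
  fixes \<iota> :: "'k::field \<Rightarrow> 'l::field"
    and \<kappa> :: "'k \<Rightarrow> 'c::alg_closed_field"
    and v :: "'l \<Rightarrow> 'g::linordered_ab_group_add extended"
    and \<nu>b :: "'c poly \<Rightarrow> 'g extended"
    and \<nu> :: "'k poly \<Rightarrow> 'g extended"
    and \<eta> :: 'l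
    and g :: "'k poly"
    and I :: "'i::wellorder set"
    and Q Qt :: "'i \<Rightarrow> 'k poly"
    and a :: "'i \<Rightarrow> 'k"
    and n :: "nat \<Rightarrow> nat"
    and w :: nat
  defines "\<nu> \<equiv> induced_valuation \<iota> \<eta> v"
  assumes extension: "simple_algebraic_extension \<iota> \<eta>"
    and valuation: "valuation v"
    and unramified_index: "ramification_index \<iota> v = 1"
    and v_eta: "v \<eta> = 0"
    and min_poly: "is_minimal_polynomial \<iota> \<eta> g"
    and closure: "algebraic_closure_of \<kappa>"
    and nu_bar: "valuation \<nu>b" "\<forall>f. \<nu>b (map_poly \<kappa> f) = \<nu> f"
    and key: "complete_sequence_of_key_polynomials \<kappa> \<nu>b \<nu> I Q"
    and degrees: "n 1 = 1" "strict_mono_on {1..w + 1} n" "n (w + 1) = degree g"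
      "(\<lambda>i. degree (Q i)) ` I = n ` {1..w + 1}"
    and classes: "\<forall>q\<in>{1..w + 1}. singleton_or_nat (deg_class Q n I q)"
    and last_class: "deg_class Q n I (w + 1) = {i_max I}"
    and scaling: "\<forall>i\<in>I_star I. v (\<iota> (a i)) = \<nu> (Q i)"
    and Qt: "\<forall>i\<in>I_star I. Qt i = smult (inverse (a i)) (Q i)" "Qt (i_max I) = g"
    and Qt_first: "Qt (LEAST i. i \<in> deg_class Q n I 1) = [:0, 1:]"
    and monic: "successively_strongly_monic \<nu> Q n w I"
  shows "\<exists>It :: nat \<Rightarrow> 'i set.
    (\<forall>q\<in>{1..w}. It q \<subseteq> deg_class Q n I q \<and> It q \<approx> deg_class Q n I q) \<and>
    (\<exists>E :: 'i \<Rightarrow> 'i \<Rightarrow> ('i, 'k) expr.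
      let J = (\<Union>q\<in>{1..w}. It q) \<union> {i_max I} in
      \<forall>l i. neat_pair Q n w J l i \<longrightarrow>
        full_expansion (\<lambda>c. v (\<iota> c)) \<nu> Q Qt n w J i (Qt l) (E l i) \<and>
        neat_of_level Q n w J (E l i) (pair_level Q n w J l i))"
proof -
  have \<nu>: "\<nu> f = v (poly (map_poly \<iota> f) \<eta>)" for f
    by (simp add: \<nu>_def induced_valuation_def)
  have \<iota>: "field_embedding \<iota>" using extension by (simp add: simple_algebraic_extension_def)
  have vK: "v (\<iota> b) = \<nu> [:b:]" for b
    by (simp add: \<nu> map_poly_pCons field_embedding_zero[OF \<iota>])
  interpret valuation_extension \<kappa> \<nu>b \<nu>
    using closure nu_bar by unfold_locales (auto simp: algebraic_closure_of_def)
  \<comment> \<open>A zero scaling factor would give Q_i infinite value and make \<eta> a root of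
    it, although the degree of Q_i is below that of the minimal polynomial.\<close>
  have nonzero: "a i \<noteq> 0" if i: "i \<in> I_star I" for i
  proof
    assume "a i = 0"
    then have "\<nu> (Q i) = \<infinity>"
      using scaling i field_embedding_zero[OF \<iota>] valuation_zero[OF valuation] by force
    then have "poly (map_poly \<iota> (Q i)) \<eta> = 0"
      using valuation_field_infinity_iff[OF valuation] by (simp add: \<nu>)
    moreover have iI: "i \<in> I" "i \<noteq> i_max I" using i by (auto simp: I_star_def)
    moreover have "Q i \<noteq> 0"
      using key iI by (auto simp: complete_sequence_of_key_polynomials_def key_polynomial_def)
    ultimately have "n (w + 1) \<le> degree (Q i)"
      using min_poly degrees(3) by (simp add: is_minimal_polynomial_def)
    moreover obtain q where q: "q \<in> {1..w + 1}" "degree (Q i) = n q"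
      using degrees(4) iI by blast
    moreover have "q \<noteq> w + 1" using last_class iI q by (auto simp: deg_class_def)
    then have "n q < n (w + 1)"
      using degrees(2) q by (intro strict_mono_onD[OF degrees(2)]) auto
    ultimately show False by simp
  qed
  interpret key_family \<kappa> \<nu>b \<nu> I Q Qt a n w "\<lambda>b. v (\<iota> b)"
    using key degrees classes last_class vK nonzero scaling Qt by unfold_locales auto
  obtain c P where "level_family \<kappa> \<nu>b \<nu> I Q Qt a n w (\<lambda>b. v (\<iota> b)) c P"
    using level_family_exists by blast
  then interpret level_family \<kappa> \<nu>b \<nu> I Q Qt a n w "\<lambda>b. v (\<iota> b)" c P .
  have "\<forall>l i. \<exists>e. neat_pair Q n w J l i \<longrightarrow>
      full_expansion (\<lambda>b. v (\<iota> b)) \<nu> Q Qt n w J i (Qt l) e \<and>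
      neat_of_level Q n w J e (pair_level Q n w J l i)"
    using neat_full_expansion by blast
  then obtain E where "\<forall>l i. neat_pair Q n w J l i \<longrightarrow>
      full_expansion (\<lambda>b. v (\<iota> b)) \<nu> Q Qt n w J i (Qt l) (E l i) \<and>
      neat_of_level Q n w J (E l i) (pair_level Q n w J l i)"
    by metis
  then show ?thesis
    unfolding J_def using c_class' eqpoll_class by (intro exI[of _ "\<lambda>q. range (c q)"]) (auto simp: Let_def)
qed

end
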